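(* Let $(\mathcal{S}_n)_{n\in\mathbb{N}}$ be the even Stern-Brocot sequence and $(\mathcal{F}_n)_{n\in\mathbb{N}}$ the Farey sequence, both defined in the context. Then, in the sense of weak convergence of finite Borel measures on $[0,1]$, \[ \lim_{n\to\infty}\ \log(n^2)\sum_{p/q\in\mathcal{S}_n} q^{-2}\,\delta_{p/q}=\lambda \qquad\text{and}\qquad \lim_{n\to\infty}\ \frac{\zeta(2)}{\log n}\sum_{p/q\in\mathcal{F}_n} q^{-2}\,\delta_{p/q}=\lambda , \] where $\lambda$ is Lebesgue measure on $[0,1]$, $\delta_x$ is the Dirac measure at $x$, and $\zeta$ is the Riemann zeta function.
   Context: All fractions $p/q$ are in lowest terms. The Farey sequence is $\mathcal{F}_n:=\{p/q: 0<p\le q\le n,\ \gcd(p,q)=1\}$. Define integers $s_{n,k},t_{n,k}$ recursively by: $s_{0,1}:=0$ and $s_{0,2}:=t_{0,1}:=t_{0,2}:=1$; $s_{n+1,2k-1}:=s_{n,k}$ and $t_{n+1,2k-1}:=t_{n,k}$ for $k=1,\dots,2^n+1$; $s_{n+1,2k}:=s_{n,k}+s_{n,k+1}$ and $t_{n+1,2k}:=t_{n,k}+t_{n,k+1}$ for $k=1,\dots,2^n$. The even Stern-Brocot sequence is $\mathcal{S}_n:=\{s_{n,2k}/t_{n,2k}: k=1,\dots,2^{n-1}\}$. Weak convergence means convergence of integrals of every continuous function $f:[0,1]\to\mathbb{R}$. *)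

theory Defs
  imports "HOL-Analysis.Analysis"
begin

text \<open>Stern-Brocot pairs: sb n k = (s_{n,k}, t_{n,k}) for k = 1..2^n+1 (1-indexed).
  Values outside that index range are irrelevant (set to (0,0)).\<close>
fun sb :: "nat \<Rightarrow> nat \<Rightarrow> nat \<times> nat" where
  "sb 0 k = (if k = 1 then (0, 1) else if k = 2 then (1, 1) else (0, 0))"
| "sb (Suc n) k =
     (if odd k then sb n ((k + 1) div 2)
      else (fst (sb n (k div 2)) + fst (sb n (k div 2 + 1)),
            snd (sb n (k div 2)) + snd (sb n (k div 2 + 1))))"

definition SB_even :: "nat \<Rightarrow> rat set" where
  "SB_even n = {of_nat (fst (sb n (2*k))) / of_nat (snd (sb n (2*k))) | k. 1 \<le> k \<and> k \<le> 2^(n-1)}"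

definition den :: "rat \<Rightarrow> int" where
  "den x = snd (quotient_of x)"

definition farey :: "nat \<Rightarrow> rat set" where
  "farey n = {x. 0 < x \<and> x \<le> 1 \<and> den x \<le> int n}"

definition zeta2 :: real where
  "zeta2 = (\<Sum>k. 1 / (real (Suc k))^2)"

end

theory Submission
  imports Defs "HOL-Real_Asymp.Real_Asymp"
begin

text \<open>
  The set \<open>S\<^sub>n\<close> is the preimage of \<open>1/2\<close> under \<open>n - 1\<close> steps of the Farey map, so its weighted sum is
  an iterate of the transfer operator \<open>P\<close>: it equals \<open>u\<^sub>n / 2\<close> with \<open>u\<^sub>n = (P\<^sup>n f)(1)\<close>. If
  \<open>x f(x)\<close> is increasing and concave, so is \<open>x (P\<^sup>n f)(x)\<close> for all \<open>n\<close>. Then \<open>u\<^sub>n\<close> is decreasing and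
  dominates \<open>x (P\<^sup>n f)(x)\<close>, so the conserved integral \<open>I\<close> of \<open>P\<^sup>n f\<close> is at most \<open>u\<^sub>n ln n + o(1)\<close>.
  Conversely, the functional equation of \<open>P\<close> along the points \<open>1/k\<close>, summed over \<open>n < N\<close>, bounds
  \<open>N I\<close> from below by \<open>(ln K - 1) (u\<^sub>0 + \<dots> + u\<^bsub>N-1\<^esub>) - O(K)\<close>; taking \<open>K = N / ln N\<close> and using
  monotonicity gives \<open>u\<^sub>n ln n \<rightarrow> I\<close>. Every monomial is a linear combination of two such \<open>f\<close>, and
  Weierstrass approximation does the rest.

  For the Farey sequence, grouping all fractions \<open>p/q\<close> by their gcd \<open>m\<close> relates the partial sums
  \<open>A(n)\<close> over reduced fractions to Riemann sums via \<open>\<Sum>\<^sub>m A(n div m) / m\<^sup>2\<close>.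
\<close>

subsection \<open>The Farey transfer operator\<close>

text \<open>The transfer operator of the Farey map for Lebesgue measure: \<open>x / (1 + x)\<close>
  and \<open>1 / (1 + x)\<close> are the inverse branches, both with Jacobian
  \<open>1 / (1 + x)^2\<close> in absolute value.\<close>

definition farey_transfer :: "(real \<Rightarrow> real) \<Rightarrow> real \<Rightarrow> real" where
  "farey_transfer f x = (f (x / (1 + x)) + f (1 / (1 + x))) / (1 + x)\<^sup>2"

lemma unit_inverse_branches:
  fixes x :: real
  assumes "x \<in> {0..1}"
  shows "x / (1 + x) \<in> {0..1/2}" "1 / (1 + x) \<in> {1/2..1}"
  using assms by (auto simp: field_simps)

lemma continuous_on_farey_transfer:
  assumes "continuous_on {0..1} f"
  shows "continuous_on {0..1} (farey_transfer f)"
proof -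
  have "continuous_on {0..1} (\<lambda>x. f (x / (1 + x)))" "continuous_on {0..1} (\<lambda>x. f (1 / (1 + x)))"
    by (rule continuous_on_compose2[OF assms];
        use unit_inverse_branches in \<open>force intro!: continuous_intros\<close>)+
  then show ?thesis
    unfolding farey_transfer_def[abs_def] by (intro continuous_intros) auto
qed

text \<open>Substitution along each inverse branch; the images [0, 1/2] and [1/2, 1] tile the unit
  interval.\<close>

lemma integral_farey_transfer:
  fixes f :: "real \<Rightarrow> real"
  assumes f: "continuous_on {0..1} f"
  shows "integral {0..1} (farey_transfer f) = integral {0..1} f"
proof -
  have "((\<lambda>x. (1 / (1 + x)\<^sup>2) *\<^sub>R f (x / (1 + x))) has_integral
        (integral {0/(1+0)..1/(1+1)} f - integral {1/(1+1)..0/(1+0)} f)) {0..1}"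
  proof (rule has_integral_substitution_general[of "{}" 0 1 _ 0 1])
    show "(\<lambda>x::real. x / (1 + x)) ` {0..1} \<subseteq> {0..1}"
      using unit_inverse_branches(1) by fastforce
    show "continuous_on {0..1} (\<lambda>x::real. x / (1 + x))"
      by (intro continuous_intros) auto
    show "((\<lambda>x. x / (1 + x)) has_real_derivative 1 / (1 + x)\<^sup>2) (at x within {0..1})"
      if "x \<in> {0..1} - {}" for x :: real
      using that by (auto intro!: derivative_eq_intros simp: power2_eq_square field_simps)
  qed (use f in auto)
  then have 1: "((\<lambda>x. f (x / (1 + x)) / (1 + x)\<^sup>2) has_integral integral {0..1/2} f) {0..1}"
    by simp
  have "((\<lambda>x. (- 1 / (1 + x)\<^sup>2) *\<^sub>R f (1 / (1 + x))) has_integral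
        (integral {1/(1+0)..1/(1+1)} f - integral {1/(1+1)..1/(1+0)} f)) {0..1}"
  proof (rule has_integral_substitution_general[of "{}" 0 1 _ 0 1])
    show "(\<lambda>x::real. 1 / (1 + x)) ` {0..1} \<subseteq> {0..1}"
      using unit_inverse_branches(2) by fastforce
    show "continuous_on {0..1} (\<lambda>x::real. 1 / (1 + x))"
      by (intro continuous_intros) auto
    show "((\<lambda>x. 1 / (1 + x)) has_real_derivative - 1 / (1 + x)\<^sup>2) (at x within {0..1})"
      if "x \<in> {0..1} - {}" for x :: real
      using that by (auto intro!: derivative_eq_intros simp: power2_eq_square field_simps)
  qed (use f in auto)
  \<comment> \<open>The second branch reverses orientation, so the substitution rule yields both
    sides with a minus sign.\<close>
  from has_integral_neg[OF this]
  have 2: "((\<lambda>x. f (1 / (1 + x)) / (1 + x)\<^sup>2) has_integral integral {1/2..1} f) {0..1}"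
    by simp
  have "integral {0..1/2} f + integral {1/2..1} f = integral {0..1} f"
    by (rule Henstock_Kurzweil_Integration.integral_combine)
      (auto intro!: integrable_continuous_interval f)
  then show ?thesis
    using has_integral_add[OF 1 2]
    by (simp add: farey_transfer_def[abs_def] add_divide_distrib integral_unique)
qed

text \<open>Derivatives are two-sided even at 0 and 1, so the chain rule applies without restriction
  to a set; the explicit second derivative reduces concavity to a sign.\<close>

definition increasing_concave :: "(real \<Rightarrow> real) \<Rightarrow> bool" where
  "increasing_concave g \<longleftrightarrow> (\<exists>g' g''. \<forall>x\<in>{0..1}.
     (g has_real_derivative g' x) (at x) \<and> (g' has_real_derivative g'' x) (at x) \<and>
     0 \<le> g' x \<and> g'' x \<le> 0)"

lemma increasing_concave_mono:
  assumes "increasing_concave g" "0 \<le> x" "x \<le> y" "y \<le> 1"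
  shows "g x \<le> g y"
  using assms unfolding increasing_concave_def
  by (force intro!: DERIV_nonneg_imp_nondecreasing[OF \<open>x \<le> y\<close>])

text \<open>Chords from the origin to a concave graph through the origin have decreasing slope; the
  multiplied-out form avoids division by 0.\<close>

lemma increasing_concave_star:
  assumes "increasing_concave g" "g 0 = 0" "0 \<le> x" "x \<le> y" "y \<le> 1"
  shows "x * g y \<le> y * g x"
proof (cases "y = 0")
  case False
  obtain g' g'' where d: "\<And>x. x \<in> {0..1} \<Longrightarrow> (g has_real_derivative g' x) (at x)"
    "\<And>x. x \<in> {0..1} \<Longrightarrow> (g' has_real_derivative g'' x) (at x)"
    "\<And>x. x \<in> {0..1} \<Longrightarrow> g'' x \<le> 0"
    using assms(1) unfolding increasing_concave_def by metis
  have "concave_on {0..1} g"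
    unfolding concave_on_def
    by (rule f''_ge0_imp_convex[where f' = "\<lambda>x. - g' x" and f'' = "\<lambda>x. - g'' x"])
      (use d in \<open>auto intro!: derivative_eq_intros\<close>)
  from concave_onD[OF this, of "x / y" 0 y] show ?thesis
    using assms False by (auto simp: field_simps)
qed (use assms in auto)

text \<open>In the coordinate \<open>u = x / (1 + x) \<in> [0, 1/2]\<close> the conjugated operator is
  \<open>(1 - u) g u + u g (1 - u)\<close>, and \<open>u\<close> is itself an increasing concave function of \<open>x\<close>.\<close>

lemma increasing_concave_step:
  assumes "increasing_concave g"
  shows "increasing_concave (\<lambda>x. (g (x / (1 + x)) + x * g (1 / (1 + x))) / (1 + x))"
proof -
  obtain g' g'' where d: "\<And>x. x \<in> {0..1} \<Longrightarrow> (g has_real_derivative g' x) (at x)"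
    "\<And>x. x \<in> {0..1} \<Longrightarrow> (g' has_real_derivative g'' x) (at x)"
    "\<And>x. x \<in> {0..1} \<Longrightarrow> 0 \<le> g' x"
    "\<And>x. x \<in> {0..1} \<Longrightarrow> g'' x \<le> 0"
    using assms(1) unfolding increasing_concave_def by metis
  \<comment> \<open>In the coordinate \<open>u\<close>, \<open>h\<close> and \<open>k\<close> are
    the first and second derivatives of \<open>(1 - u) * g u + u * g (1 - u)\<close>. Since du/dx is
    \<open>1 / (1 + x)^2\<close>, the chain rule produces the two witnesses below.\<close>
  define h where "h x = g (1 / (1 + x)) - g (x / (1 + x))
     + 1 / (1 + x) * g' (x / (1 + x)) - x / (1 + x) * g' (1 / (1 + x))" for x
  define k where "k x = - 2 * g' (1 / (1 + x)) - 2 * g' (x / (1 + x))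
     + 1 / (1 + x) * g'' (x / (1 + x)) + x / (1 + x) * g'' (1 / (1 + x))" for x
  show ?thesis
    unfolding increasing_concave_def
  proof (rule exI[of _ "\<lambda>x. h x / (1 + x)\<^sup>2"],
      rule exI[of _ "\<lambda>x. k x / (1 + x) ^ 4 - 2 * h x / (1 + x) ^ 3"], intro ballI conjI)
    fix x :: real assume x: "x \<in> {0..1}"
    define u v where "u = x / (1 + x)" and "v = 1 / (1 + x)"
    have uv: "u \<in> {0..1}" "v \<in> {0..1}" "u \<le> v" "u + v = 1" and v0: "v > 0"
      using x unit_inverse_branches[OF x]
      by (auto simp: u_def v_def divide_right_mono simp flip: add_divide_distrib)
    have h: "h x = g v - g u + v * g' u - u * g' v"
      and k: "k x = - 2 * g' v - 2 * g' u + v * g'' u + u * g'' v"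
      by (simp_all add: h_def k_def u_def v_def)
    have du: "((\<lambda>x. x / (1 + x)) has_real_derivative v\<^sup>2) (at x)"
      and dv: "((\<lambda>x. 1 / (1 + x)) has_real_derivative - v\<^sup>2) (at x)"
      using x by (auto intro!: derivative_eq_intros simp: v_def power2_eq_square field_simps)
    have D1: "((\<lambda>x. g (x / (1 + x))) has_real_derivative g' u * v\<^sup>2) (at x)"
      "((\<lambda>x. g (1 / (1 + x))) has_real_derivative g' v * - v\<^sup>2) (at x)"
      using DERIV_chain2[OF d(1) du] DERIV_chain2[OF d(1) dv] uv by (auto simp: u_def v_def)
    have D2: "((\<lambda>x. g' (x / (1 + x))) has_real_derivative g'' u * v\<^sup>2) (at x)"
      "((\<lambda>x. g' (1 / (1 + x))) has_real_derivative g'' v * - v\<^sup>2) (at x)"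
      using DERIV_chain2[OF d(2) du] DERIV_chain2[OF d(2) dv] uv by (auto simp: u_def v_def)
    have vv: "1 / (1 + x) = v" "x / (1 + x) = u" by (simp_all add: u_def v_def)
    have alt: "(\<lambda>x. (g (x / (1 + x)) + x * g (1 / (1 + x))) / (1 + x)) =
       (\<lambda>x. (1 / (1 + x)) * g (x / (1 + x)) + (x / (1 + x)) * g (1 / (1 + x)))"
      by (auto simp: add_divide_distrib)
    have "((\<lambda>x. (1 / (1 + x)) * g (x / (1 + x)) + (x / (1 + x)) * g (1 / (1 + x)))
      has_real_derivative (- v\<^sup>2 * g u + g' u * v\<^sup>2 * v) + (v\<^sup>2 * g v + (g' v * - v\<^sup>2) * u)) (at x)"
      using DERIV_add[OF DERIV_mult[OF dv D1(1)] DERIV_mult[OF du D1(2)]] unfolding vv .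
    also have "(- v\<^sup>2 * g u + g' u * v\<^sup>2 * v) + (v\<^sup>2 * g v + (g' v * - v\<^sup>2) * u) = v\<^sup>2 * h x"
      unfolding h by algebra
    also have "\<dots> = h x / (1 + x)\<^sup>2" by (simp add: v_def power_divide)
    finally show "((\<lambda>x. (g (x / (1 + x)) + x * g (1 / (1 + x))) / (1 + x)) has_real_derivative
       h x / (1 + x)\<^sup>2) (at x)" unfolding alt .
    have "(h has_real_derivative g' v * - v\<^sup>2 - g' u * v\<^sup>2 + (- v\<^sup>2 * g' u + (g'' u * v\<^sup>2) * v)
       - (v\<^sup>2 * g' v + (g'' v * - v\<^sup>2) * u)) (at x)"
      using DERIV_diff[OF DERIV_add[OF DERIV_diff[OF D1(2) D1(1)] DERIV_mult[OF dv D2(1)]]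
          DERIV_mult[OF du D2(2)]]
      unfolding vv h_def[abs_def] .
    also have "g' v * - v\<^sup>2 - g' u * v\<^sup>2 + (- v\<^sup>2 * g' u + (g'' u * v\<^sup>2) * v)
       - (v\<^sup>2 * g' v + (g'' v * - v\<^sup>2) * u) = v\<^sup>2 * k x"
      unfolding k by algebra
    finally have dh: "(h has_real_derivative k x / (1 + x)\<^sup>2) (at x)"
      by (simp add: v_def power_divide)
    have pos: "0 < 1 + x" using x by simp
    then have sq: "(1 + x)\<^sup>2 \<noteq> 0" by simp
    have quot: "(a / y\<^sup>2 * y\<^sup>2 - b * (2 * y)) / (y\<^sup>2 * y\<^sup>2) = a / y ^ 4 - 2 * b / y ^ 3"
      if "0 < y" for a b y :: real
    proof -
      have "y\<^sup>2 * y\<^sup>2 = y ^ 4" "y ^ 4 = y * y ^ 3" by (simp_all add: power_numeral_reduce)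
      then show ?thesis using that by (simp add: diff_divide_distrib)
    qed
    have dsq: "((\<lambda>x. (1 + x)\<^sup>2) has_real_derivative 2 * (1 + x)) (at x)"
      by (auto intro!: derivative_eq_intros)
    have "((\<lambda>x. h x / (1 + x)\<^sup>2) has_real_derivative
        (k x / (1 + x)\<^sup>2 * (1 + x)\<^sup>2 - h x * (2 * (1 + x))) / ((1 + x)\<^sup>2 * (1 + x)\<^sup>2)) (at x)"
      by (rule DERIV_divide[OF dh dsq sq])
    also have "(k x / (1 + x)\<^sup>2 * (1 + x)\<^sup>2 - h x * (2 * (1 + x))) / ((1 + x)\<^sup>2 * (1 + x)\<^sup>2) =
        k x / (1 + x) ^ 4 - 2 * h x / (1 + x) ^ 3"
      by (rule quot[OF pos])
    finally show "((\<lambda>x. h x / (1 + x)\<^sup>2) has_real_derivative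
        k x / (1 + x) ^ 4 - 2 * h x / (1 + x) ^ 3) (at x)" .
    \<comment> \<open>For \<open>h x \<ge> 0\<close>: \<open>g v - g u\<close> is nonnegative
      because \<open>g\<close> increases, and \<open>v * g' u - u * g' v\<close> because
      \<open>u \<le> v\<close> and \<open>g'\<close> decreases.\<close>
    have g'mono: "g' v \<le> g' u"
    proof (rule DERIV_nonpos_imp_nonincreasing[OF \<open>u \<le> v\<close>])
      fix z assume "u \<le> z" "z \<le> v"
      then have "z \<in> {0..1}" using uv(1,2) by auto
      with d(2,4) show "\<exists>y. (g' has_real_derivative y) (at z) \<and> y \<le> 0" by blast
    qed
    have "u * g' v \<le> v * g' u"
      using uv(3) g'mono less_imp_le[OF v0] d(3)[OF uv(2)] by (rule mult_mono)
    then have h0: "h x \<ge> 0"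
      using increasing_concave_mono[OF assms, of u v] uv(1-3) unfolding h by simp
    then show "0 \<le> h x / (1 + x)\<^sup>2" by simp
    \<comment> \<open>Every summand of \<open>k x\<close> is nonpositive; the remaining term of the
      second derivative is a negative multiple of \<open>h x\<close>.\<close>
    have "v * g'' u \<le> 0" "u * g'' v \<le> 0"
      using d(4)[OF uv(1)] d(4)[OF uv(2)] uv(1) v0 by (simp_all add: mult_nonneg_nonpos)
    then have "k x \<le> 0" unfolding k using d(3)[OF uv(1)] d(3)[OF uv(2)] by linarith
    then have "k x / (1 + x) ^ 4 \<le> 0" "2 * h x / (1 + x) ^ 3 \<ge> 0"
      using x h0 by (auto simp: divide_nonpos_pos)
    then show "k x / (1 + x) ^ 4 - 2 * h x / (1 + x) ^ 3 \<le> 0" by linarith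
  qed
qed

text \<open>With \<open>g y = y * f y\<close> the right side is the operator of
  \<open>increasing_concave_step\<close>: conjugation by multiplication with \<open>x\<close> leaves
  an average with weights \<open>1 / (1 + x)\<close> and \<open>x / (1 + x)\<close>.\<close>

lemma mult_farey_transfer:
  "x * farey_transfer f x =
     (x / (1 + x) * f (x / (1 + x)) + x * (1 / (1 + x) * f (1 / (1 + x)))) / (1 + x)"
  by (simp add: farey_transfer_def add_divide_distrib power2_eq_square algebra_simps)

lemma farey_transfer_linear:
  "farey_transfer (\<lambda>x. a * f x + b * g x) = (\<lambda>x. a * farey_transfer f x + b * farey_transfer g x)"
  by (simp add: farey_transfer_def fun_eq_iff add_divide_distrib algebra_simps)

lemma funpow_farey_transfer_linear:
  "(farey_transfer ^^ n) (\<lambda>x. a * f x + b * g x) =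
     (\<lambda>x. a * (farey_transfer ^^ n) f x + b * (farey_transfer ^^ n) g x)"
  by (induction n) (simp_all add: farey_transfer_linear)

subsection \<open>Iterates on increasing concave functions\<close>

text \<open>The non-integrable function \<open>1 / x\<close> is fixed by
  \<open>farey_transfer\<close>, so \<open>x * f x\<close> is \<open>f\<close> measured against the
  infinite invariant density.\<close>

locale concave_weight =
  fixes f :: "real \<Rightarrow> real"
  assumes cont: "continuous_on {0..1} f"
    and conc: "increasing_concave (\<lambda>x. x * f x)"
begin

abbreviation F :: "nat \<Rightarrow> real \<Rightarrow> real" where "F n \<equiv> (farey_transfer ^^ n) f"
abbreviation u :: "nat \<Rightarrow> real" where "u n \<equiv> F n 1"
abbreviation U :: "nat \<Rightarrow> real" where "U N \<equiv> (\<Sum>n<N. u n)"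
abbreviation I :: real where "I \<equiv> integral {0..1} f"

lemma cont_F: "continuous_on {0..1} (F n)"
  by (induction n) (auto intro: continuous_on_farey_transfer cont)

lemma integral_F: "integral {0..1} (F n) = I"
  by (induction n) (auto simp: integral_farey_transfer cont_F)

lemma conc_F: "increasing_concave (\<lambda>x. x * F n x)"
proof (induction n)
  case (Suc n)
  from increasing_concave_step[OF this] show ?case
    by (simp add: mult_farey_transfer)
qed (simp add: conc)

lemma mult_F_mono: "0 \<le> x \<Longrightarrow> x \<le> y \<Longrightarrow> y \<le> 1 \<Longrightarrow> x * F n x \<le> y * F n y"
  using increasing_concave_mono[OF conc_F] by blast

lemma F_antimono_pos:
  assumes "0 < x" "x \<le> y" "y \<le> 1"
  shows "F n y \<le> F n x"
  using increasing_concave_star[OF conc_F[of n], of x y] assms by (simp add: algebra_simps)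

text \<open>Concavity of \<open>x * F n x\<close> settles \<open>x > 0\<close>; at
  \<open>x = 0\<close> that product carries no information about \<open>F n 0\<close>, so the
  inequality comes from continuity there.\<close>

lemma F_antimono:
  assumes "0 \<le> x" "x \<le> y" "y \<le> 1"
  shows "F n y \<le> F n x"
proof (cases "x = 0")
  case True
  show ?thesis
  proof (cases "y = 0")
    case False
    have "((F n) \<longlongrightarrow> F n 0) (at 0 within {0..1})"
      using cont_F[of n] by (auto simp: continuous_on_def)
    then have "((F n) \<longlongrightarrow> F n 0) (at_right 0)"
      by (simp add: at_within_Icc_at_right)
    moreover have "\<forall>\<^sub>F z in at_right 0. F n y \<le> F n z"
      by (rule eventually_at_rightI[of 0 y]) (use assms False F_antimono_pos in auto)
    ultimately show ?thesis
      using True by (intro tendsto_lowerbound) auto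
  qed (use True in auto)
qed (use assms F_antimono_pos in auto)

section \<open>Values at the endpoints 0 and 1, and the upper bound for the integral\<close>

lemma u_nonneg: "0 \<le> u n"
  using mult_F_mono[of 0 1 n] by simp

lemma F_nonneg: "0 \<le> x \<Longrightarrow> x \<le> 1 \<Longrightarrow> 0 \<le> F n x"
  using F_antimono[of x 1 n] u_nonneg[of n] by simp

text \<open>Both inverse branches send 1 to 1/2.\<close>

lemma u_Suc: "u (Suc n) = F n (1/2) / 2"
  by (simp add: farey_transfer_def)

lemma u_decseq: "decseq u"
proof (rule decseq_SucI)
  show "u (Suc n) \<le> u n" for n
    using mult_F_mono[of "1/2" 1 n] unfolding u_Suc by simp
qed

text \<open>0 is a neutral fixed point: the branches send it to 0 and 1 with Jacobian 1, so each
  step adds the current value at 1.\<close>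

lemma F_zero: "F n 0 = f 0 + U n"
  by (induction n) (auto simp: farey_transfer_def)

text \<open>The integral of \<open>F n\<close> is split at \<open>1 / n\<close>: below it
  \<open>F n\<close> is at most \<open>F n 0\<close>, above it \<open>F n x\<close> is at most
  \<open>u n / x\<close>.\<close>

lemma integral_le_u:
  assumes "n > 0"
  shows "I \<le> (f 0 + U n) / n + u n * ln n"
proof -
  have n: "0 < 1 / real n" "1 / real n \<le> 1" using assms by auto
  have int: "F n integrable_on {a..b}" if "0 \<le> a" "b \<le> 1" for a b
    by (intro integrable_continuous_interval continuous_on_subset[OF cont_F]) (use that in auto)
  have "integral {0..1/n} (F n) \<le> integral {0..1/n} (\<lambda>_. F n 0)"
  proof (intro integral_le int)
    show "F n x \<le> F n 0" if "x \<in> {0..1/n}" for x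
      by (rule F_antimono) (use that n(2) in \<open>auto intro: order_trans\<close>)
  qed (use n in auto)
  also have "\<dots> = (f 0 + U n) / n" using n by (simp add: F_zero)
  finally have 1: "integral {0..1/n} (F n) \<le> (f 0 + U n) / n" .
  have "((\<lambda>x. u n * (1 / x)) has_integral (u n * (ln 1 - ln (1 / n)))) {1/n..1}"
    by (intro has_integral_mult_right fundamental_theorem_of_calculus)
      (use n(2) less_le_trans[OF n(1)] in \<open>auto intro!: derivative_eq_intros
        simp: divide_inverse simp flip: has_real_derivative_iff_has_vector_derivative\<close>)
  then have h: "((\<lambda>x. u n * (1 / x)) has_integral (u n * ln n)) {1/n..1}"
    using assms by (simp add: ln_div)
  have "integral {1/n..1} (F n) \<le> u n * ln n"
  proof (rule has_integral_le[OF integrable_integral h])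
    show "F n integrable_on {1/n..1}" by (rule int) (use n in auto)
    fix x assume "x \<in> {1/n..1}"
    then have "0 < x" "x \<le> 1" using n(1) by (meson atLeastAtMost_iff less_le_trans)+
    then show "F n x \<le> u n * (1 / x)"
      using mult_F_mono[of x 1 n] by (simp add: field_simps)
  qed
  moreover have "integral {0..1/n} (F n) + integral {1/n..1} (F n) = integral {0..1} (F n)"
    by (rule Henstock_Kurzweil_Integration.integral_combine) (use n int in auto)
  ultimately show ?thesis using 1 integral_F by simp
qed

text \<open>Induction along the points \<open>1 / s\<close>: the operator relates
  \<open>1 / s\<close> to \<open>1 / (s + 1)\<close> and \<open>s / (s + 1)\<close>, and at the
  latter point \<open>mult_F_mono\<close> bounds \<open>F n\<close> through \<open>u n\<close>. The
  case \<open>k = 0\<close> is an equality.\<close>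

lemma sum_F_reciprocal_ge:
  "(\<Sum>n<N. F n (1 / Suc k)) / (real (Suc k))\<^sup>2 \<ge> U N / Suc k - 2 * f 0 * (1 - 1 / Suc k)"
proof (induction k)
  case (Suc k)
  define s where "s = real (Suc k)"
  have s: "s \<ge> 1" "real (Suc (Suc k)) = s + 1" by (auto simp: s_def)
  have step: "F (Suc n) (1 / s) / s\<^sup>2 \<le> F n (1 / (s + 1)) / (s + 1)\<^sup>2 + u n / (s * (s + 1))" for n
  proof -
    have a: "1 / s / (1 + 1 / s) = 1 / (s + 1)" "1 / (1 + 1 / s) = s / (s + 1)"
      "(1 + 1 / s)\<^sup>2 = (s + 1)\<^sup>2 / s\<^sup>2"
      using s(1) by (auto simp: field_simps power2_eq_square)
    have "F (Suc n) (1 / s) = (F n (1 / (s + 1)) + F n (s / (s + 1))) / ((s + 1)\<^sup>2 / s\<^sup>2)"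
      by (simp only: funpow.simps o_apply farey_transfer_def a)
    then have "F (Suc n) (1 / s) / s\<^sup>2 = (F n (1 / (s + 1)) + F n (s / (s + 1))) / (s + 1)\<^sup>2"
      using s(1) by simp
    also have "s / (s + 1) * F n (s / (s + 1)) \<le> u n"
      using mult_F_mono[of "s / (s + 1)" 1 n] s(1) by simp
    then have "F n (s / (s + 1)) \<le> u n * (s + 1) / s"
      using s(1) by (simp add: field_simps)
    then have "(F n (1 / (s + 1)) + F n (s / (s + 1))) / (s + 1)\<^sup>2 \<le>
        (F n (1 / (s + 1)) + u n * (s + 1) / s) / (s + 1)\<^sup>2"
      by (intro divide_right_mono) auto
    also have "\<dots> = F n (1 / (s + 1)) / (s + 1)\<^sup>2 + u n / (s * (s + 1))"
      using s(1) by (simp add: divide_simps power2_eq_square)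
    finally show ?thesis .
  qed
  \<comment> \<open>Shifting the index \<open>n\<close> by one costs only boundary terms:
    \<open>F N (1 / s)\<close> is dropped and \<open>f (1 / s)\<close> is replaced by
    \<open>f 0\<close>.\<close>
  have "(\<Sum>n<N. F n (1 / s)) + F N (1 / s) = f (1 / s) + (\<Sum>n<N. F (Suc n) (1 / s))"
    using sum.lessThan_Suc_shift[of "\<lambda>n. F n (1 / s)" N] by simp
  moreover have "0 \<le> F N (1 / s)" "f (1 / s) \<le> f 0"
    using F_nonneg[of "1/s" N] F_antimono[of 0 "1/s" 0] s(1) by auto
  ultimately have "(\<Sum>n<N. F n (1 / s)) \<le> f 0 + (\<Sum>n<N. F (Suc n) (1 / s))"
    by linarith
  then have "(\<Sum>n<N. F n (1 / s)) / s\<^sup>2 \<le> (f 0 + (\<Sum>n<N. F (Suc n) (1 / s))) / s\<^sup>2"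
    by (rule divide_right_mono) simp
  also have "\<dots> = f 0 / s\<^sup>2 + (\<Sum>n<N. F (Suc n) (1 / s) / s\<^sup>2)"
    by (simp add: add_divide_distrib sum_divide_distrib)
  also have "(\<Sum>n<N. F (Suc n) (1 / s) / s\<^sup>2) \<le>
      (\<Sum>n<N. F n (1 / (s + 1)) / (s + 1)\<^sup>2 + u n / (s * (s + 1)))"
    by (intro sum_mono step)
  also have "\<dots> = (\<Sum>n<N. F n (1 / (s + 1))) / (s + 1)\<^sup>2 + U N / (s * (s + 1))"
    by (simp add: sum.distrib sum_divide_distrib)
  finally have 1: "(\<Sum>n<N. F n (1 / s)) / s\<^sup>2 \<le>
    f 0 / s\<^sup>2 + ((\<Sum>n<N. F n (1 / (s + 1))) / (s + 1)\<^sup>2 + U N / (s * (s + 1)))" by simp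
  have "f 0 \<ge> 0" using F_nonneg[of 0 0] by simp
  \<comment> \<open>The factor 2 replaces \<open>1 / s^2\<close> by a difference of reciprocals, so
    that the accumulated errors telescope.\<close>
  moreover have "1 / s\<^sup>2 \<le> 2 / (s * (s + 1))"
    using s(1) by (simp add: divide_simps power2_eq_square)
  ultimately have "f 0 * (1 / s\<^sup>2) \<le> f 0 * (2 / (s * (s + 1)))"
    by (rule mult_left_mono[rotated])
  also have "2 / (s * (s + 1)) = 2 * (1 / s - 1 / (s + 1))"
    using s(1) by (simp add: divide_simps)
  finally have 2: "f 0 / s\<^sup>2 \<le> f 0 * (2 * (1 / s - 1 / (s + 1)))" by simp
  have 3: "U N / (s * (s + 1)) = U N / s - U N / (s + 1)"
    using s(1) by (simp add: field_simps)
  have IH: "(\<Sum>n<N. F n (1 / s)) / s\<^sup>2 \<ge> U N / s - 2 * f 0 * (1 - 1 / s)"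
    using Suc by (simp add: s_def)
  show ?case unfolding s(2)
    using 1 2 3 IH by (simp add: algebra_simps)
qed simp

text \<open>A lower Riemann sum on the partition by the points \<open>1 / k\<close>; as
  \<open>F n\<close> decreases, the right endpoint of each cell gives the minimum.\<close>

lemma integral_ge_sum_F:
  "I \<ge> (\<Sum>k<K. F n (1 / Suc k) * (1 / Suc k - 1 / Suc (Suc k)))"
proof -
  have int: "F n integrable_on {a..b}" if "0 \<le> a" "b \<le> 1" for a b
    by (intro integrable_continuous_interval continuous_on_subset[OF cont_F]) (use that in auto)
  have "(\<Sum>k<K. F n (1 / Suc k) * (1 / Suc k - 1 / Suc (Suc k))) \<le> integral {1/Suc K..1} (F n)"
  proof (induction K)
    case (Suc K)
    have le: "1 / real (Suc (Suc K)) \<le> 1 / Suc K" by (simp add: field_simps)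
    have "F n (1 / Suc K) * (1 / Suc K - 1 / Suc (Suc K)) =
      integral {1/Suc (Suc K)..1/Suc K} (\<lambda>_. F n (1 / Suc K))"
      using le by simp
    also have "\<dots> \<le> integral {1/Suc (Suc K)..1/Suc K} (F n)"
    proof (intro integral_le int)
      fix x :: real assume x: "x \<in> {1/Suc (Suc K)..1/Suc K}"
      have "0 \<le> 1 / real (Suc (Suc K))" by simp
      then have "0 \<le> x" using x by (meson atLeastAtMost_iff order_trans)
      then show "F n (1 / Suc K) \<le> F n x" using x by (intro F_antimono) auto
    qed auto
    finally have "F n (1 / Suc K) * (1 / Suc K - 1 / Suc (Suc K)) \<le> \<dots>" .
    moreover have "integral {1/Suc (Suc K)..1/Suc K} (F n) + integral {1/Suc K..1} (F n) =
      integral {1/Suc (Suc K)..1} (F n)"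
      by (rule Henstock_Kurzweil_Integration.integral_combine) (use le int in auto)
    ultimately show ?case using Suc by simp
  qed simp
  also have "\<dots> \<le> integral {0..1} (F n)"
    by (intro integral_subset_le int) (use F_nonneg in auto)
  finally show ?thesis by (simp add: integral_F)
qed

text \<open>Summing \<open>integral_ge_sum_F\<close> over \<open>n < N\<close> and inserting
  \<open>sum_F_reciprocal_ge\<close> leaves a harmonic sum as the factor of \<open>U N\<close>,
  since a cell has length \<open>s / (s + 1)\<close> times \<open>1 / s^2\<close>.\<close>

lemma U_mult_ln_le: "U N * (ln (real K + 1) - 1) \<le> real N * I + 2 * f 0 * real K"
proof -
  have f0: "f 0 \<ge> 0" using F_nonneg[of 0 0] by simp
  have "U N * (\<Sum>k<K. 1 / real (Suc (Suc k))) - 2 * f 0 * real K =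
      (\<Sum>k<K. U N / real (Suc (Suc k)) - 2 * f 0)"
    by (simp add: sum_subtractf sum_distrib_left)
  also have "\<dots> \<le> (\<Sum>k<K. (\<Sum>n<N. F n (1 / Suc k)) * (1 / Suc k - 1 / Suc (Suc k)))"
  proof (rule sum_mono)
    fix k
    define s where "s = real (Suc k)"
    have s: "s \<ge> 1" "real (Suc (Suc k)) = s + 1" by (auto simp: s_def)
    have a: "1 / s - 1 / (s + 1) = s / (s + 1) * (1 / s\<^sup>2)"
      using s(1) by (simp add: divide_simps power2_eq_square)
    have b: "1 - 1 / s \<le> 1" "0 \<le> 1 - 1/s" "s / (s + 1) \<le> 1" "0 \<le> s / (s + 1)" using s(1) by auto
    have "s / (s + 1) * (1 - 1 / s) \<le> 1" using s(1) by (simp add: divide_simps)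
    then have "2 * f 0 * (s / (s + 1) * (1 - 1 / s)) \<le> 2 * f 0"
      using f0 by (intro mult_left_le) auto
    moreover have "s / (s + 1) * (U N / s) = U N / (s + 1)" using s(1) by simp
    ultimately have "U N / (s + 1) - 2 * f 0 \<le> s / (s + 1) * (U N / s - 2 * f 0 * (1 - 1 / s))"
      unfolding right_diff_distrib[of "s / (s + 1)" "U N / s"]
      by (simp only: mult.left_commute[of "s / (s + 1)"])
    also have "\<dots> \<le> s / (s + 1) * ((\<Sum>n<N. F n (1 / s)) / s\<^sup>2)"
      using sum_F_reciprocal_ge[of N k] b by (intro mult_left_mono) (auto simp: s_def)
    also have "\<dots> = (\<Sum>n<N. F n (1 / s)) * (1 / s - 1 / (s + 1))" by (simp add: a)
    finally show "U N / Suc (Suc k) - 2 * f 0 \<le>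
      (\<Sum>n<N. F n (1 / Suc k)) * (1 / Suc k - 1 / Suc (Suc k))"
      unfolding s(2) by (simp add: s_def)
  qed
  also have "\<dots> = (\<Sum>n<N. \<Sum>k<K. F n (1 / Suc k) * (1 / Suc k - 1 / Suc (Suc k)))"
    unfolding sum_distrib_right by (rule sum.swap)
  also have "\<dots> \<le> (\<Sum>n<N. I)" by (intro sum_mono integral_ge_sum_F)
  finally have 1: "U N * (\<Sum>k<K. 1 / real (Suc (Suc k))) \<le> N * I + 2 * f 0 * K" by simp
  \<comment> \<open>The harmonic sum starts at 1/2, which accounts for the subtracted 1.\<close>
  have "ln (real K + 1) \<le> ln (real (Suc K) + 1)" by simp
  then have "ln (real K + 1) - 1 \<le> harm (Suc K) - 1"
    using ln_le_harm[of "Suc K"] by linarith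
  also have "harm (Suc K) - 1 = (\<Sum>k<K. 1 / real (Suc (Suc k)))"
    by (induction K) (auto simp: harm_def inverse_eq_divide)
  finally have "U N * (ln (real K + 1) - 1) \<le> U N * (\<Sum>k<K. 1 / real (Suc (Suc k)))"
    by (intro mult_left_mono sum_nonneg u_nonneg) (auto simp: add.commute)
  with 1 show ?thesis by linarith
qed

lemma u_le_U: "N * u N \<le> U N"
proof -
  have "(\<Sum>n<N. u N) \<le> U N"
    using u_decseq by (intro sum_mono) (auto simp: decseq_def)
  then show ?thesis by simp
qed

lemma U_upper:
  "\<forall>\<^sub>F N in sequentially. U N / N \<le> (I + 2 * f 0 / ln N) / (ln (N / ln N) - 1)"
proof -
  have "\<forall>\<^sub>F N in sequentially. ln (real N / ln N) - 1 > 0" by real_asymp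
  moreover have "\<forall>\<^sub>F N in sequentially. ln (real N) > 0" by real_asymp
  ultimately show ?thesis
    using eventually_gt_at_top[of 0]
  proof eventually_elim
    case (elim N)
    \<comment> \<open>This choice makes the error \<open>2 * f 0 * K\<close>, divided by
      \<open>N\<close>, of order \<open>1 / ln N\<close>, while \<open>ln K\<close> is still
      asymptotic to \<open>ln N\<close>.\<close>
    define K where "K = nat \<lfloor>N / ln N\<rfloor>"
    have K: "real K \<le> N / ln N" "N / ln N \<le> real K + 1"
      using elim unfolding K_def by auto
    have f0: "f 0 \<ge> 0" using F_nonneg[of 0 0] by simp
    have "ln (N / ln N) - 1 \<le> ln (real K + 1) - 1"
      using K elim by simp
    then have "U N * (ln (N / ln N) - 1) \<le> U N * (ln (real K + 1) - 1)"
      by (intro mult_left_mono sum_nonneg u_nonneg)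
    also have "\<dots> \<le> N * I + 2 * f 0 * K" using U_mult_ln_le[of N K] by (simp add: add.commute)
    also have "\<dots> \<le> N * I + 2 * f 0 * (N / ln N)"
      using f0 K by (intro add_left_mono mult_left_mono) auto
    also have "\<dots> = N * (I + 2 * f 0 / ln N)" by (simp add: algebra_simps)
    finally show ?case using elim by (simp add: field_simps)
  qed
qed

text \<open>The lower bound is \<open>integral_le_u\<close>. For the upper bound, \<open>u N\<close>
  is at most the mean \<open>U N / N\<close> because \<open>u\<close> decreases, and
  \<open>U_upper\<close> bounds the mean.\<close>

lemma u_mult_ln_tendsto: "(\<lambda>n. u n * ln n) \<longlonglongrightarrow> I"
proof (rule tendsto_sandwich)
  show "\<forall>\<^sub>F N in sequentially. I - (f 0 / real N + U N / N) \<le> u N * ln N"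
    using eventually_gt_at_top[of 0]
  proof eventually_elim
    case (elim N)
    from integral_le_u[OF this] show ?case by (simp add: add_divide_distrib)
  qed
  show "\<forall>\<^sub>F N in sequentially. u N * ln N \<le> (I + 2 * f 0 / ln N) / (ln (N / ln N) - 1) * ln N"
    using U_upper eventually_gt_at_top[of 0]
  proof eventually_elim
    case (elim N)
    have "u N \<le> U N / N" using u_le_U[of N] elim by (simp add: field_simps)
    with elim show ?case by (intro mult_right_mono) auto
  qed
  have num: "(\<lambda>N. I + 2 * f 0 / ln (real N)) \<longlonglongrightarrow> I"
  proof -
    have "(\<lambda>N. 2 * f 0 / ln (real N)) \<longlonglongrightarrow> 0"
      by real_asymp
    from tendsto_add[OF tendsto_const this] show ?thesis by simp
  qed
  show "(\<lambda>N. (I + 2 * f 0 / ln (real N)) / (ln (N / ln N) - 1) * ln N) \<longlonglongrightarrow> I"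
  proof -
    have "(\<lambda>N. 1 / (ln (real N / ln N) - 1) * ln N) \<longlonglongrightarrow> 1"
      by real_asymp
    from tendsto_mult[OF num this] show ?thesis by simp
  qed
  \<comment> \<open>The upper bound for the mean also removes the error that the interval near 0
    contributes to the lower bound.\<close>
  have U0: "(\<lambda>N. U N / N) \<longlonglongrightarrow> 0"
  proof (rule tendsto_sandwich[OF _ U_upper tendsto_const])
    have "(\<lambda>N. 1 / (ln (real N / ln N) - 1)) \<longlonglongrightarrow> 0"
      by real_asymp
    from tendsto_mult[OF num this]
    show "(\<lambda>N. (I + 2 * f 0 / ln (real N)) / (ln (N / ln N) - 1)) \<longlonglongrightarrow> 0" by simp
  qed (auto intro!: always_eventually divide_nonneg_nonneg sum_nonneg u_nonneg)
  have "(\<lambda>N. f 0 / real N) \<longlonglongrightarrow> 0" by real_asymp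
  from tendsto_diff[OF tendsto_const[of I] tendsto_add[OF this U0]]
  show "(\<lambda>N. I - (f 0 / real N + U N / N)) \<longlonglongrightarrow> I" by simp
qed

end

subsection \<open>Stern-Brocot pairs and Farey fractions\<close>

text \<open>These two maps are the inverse branches \<open>x / (1 + x)\<close> and
  \<open>1 / (1 + x)\<close> acting on numerator and denominator.\<close>

abbreviation left_pair :: "nat \<times> nat \<Rightarrow> nat \<times> nat" where
  "left_pair x \<equiv> (fst x, fst x + snd x)"

abbreviation right_pair :: "nat \<times> nat \<Rightarrow> nat \<times> nat" where
  "right_pair x \<equiv> (snd x, fst x + snd x)"

lemma sb_Suc_even:
  "sb (Suc n) (2 * k) =
     (fst (sb n k) + fst (sb n (k + 1)), snd (sb n k) + snd (sb n (k + 1)))"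
  by simp

lemma sb_Suc_odd: "sb (Suc n) (2 * k + 1) = sb n (k + 1)"
  by simp

text \<open>\<open>left_pair\<close> is additive and so commutes with taking mediants; it therefore
  suffices that it maps the initial row correctly.\<close>

lemma sb_left_half:
  assumes "1 \<le> k" "k \<le> 2 ^ n + 1"
  shows "sb (Suc n) k = left_pair (sb n k)"
  using assms
proof (induction n arbitrary: k)
  case 0
  then have "k = 1 \<or> k = 2" by auto
  then show ?case by auto
next
  case (Suc n)
  show ?case
  proof (cases "odd k")
    case True
    then have "sb (Suc (Suc n)) k = sb (Suc n) ((k + 1) div 2)" "sb (Suc n) k = sb n ((k + 1) div 2)"
      by simp_all
    moreover have "1 \<le> (k + 1) div 2" "(k + 1) div 2 \<le> 2 ^ n + 1"
      using Suc.prems True by (auto elim!: oddE)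
    ultimately show ?thesis using Suc.IH[of "(k + 1) div 2"] by simp
  next
    case False
    then obtain j where j: "k = 2 * j" by (auto elim: evenE)
    then have "1 \<le> j" "j \<le> 2 ^ n" using Suc.prems by auto
    then have "sb (Suc n) j = left_pair (sb n j)" "sb (Suc n) (j + 1) = left_pair (sb n (j + 1))"
      using Suc.IH[of j] Suc.IH[of "j + 1"] by simp_all
    then show ?thesis
      by (simp add: j del: sb.simps add: sb.simps(2)[of "Suc n" "2 * j"] sb.simps(2)[of n "2 * j"])
  qed
qed

text \<open>The same argument for the second branch, which reverses order; hence the mirrored
  index.\<close>

lemma sb_right_half:
  assumes "1 \<le> k" "k \<le> 2 ^ n + 1"
  shows "sb (Suc n) (2 ^ n + k) = right_pair (sb n (2 ^ n + 2 - k))"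
  using assms
proof (induction n arbitrary: k)
  case 0
  then have "k = 1 \<or> k = 2" by auto
  then show ?case by auto
next
  case (Suc n)
  show ?case
  proof (cases "odd k")
    case True
    then obtain j where j: "k = 2 * j + 1" by (auto elim: oddE)
    then have b: "j \<le> 2 ^ n" using Suc.prems by auto
    have "2 ^ Suc n + k = 2 * (2 ^ n + j) + 1" using j by simp
    then have "sb (Suc (Suc n)) (2 ^ Suc n + k) = sb (Suc n) (2 ^ n + (j + 1))"
      by (simp only: sb_Suc_odd add.assoc)
    also have "\<dots> = right_pair (sb n (2 ^ n + 1 - j))"
      using Suc.IH[of "j + 1"] b by (simp del: sb.simps)
    also have "2 ^ Suc n + 2 - k = 2 * (2 ^ n - j) + 1" using j b by auto
    then have "sb (Suc n) (2 ^ Suc n + 2 - k) = sb n (2 ^ n - j + 1)"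
      by (simp only: sb_Suc_odd)
    then have "sb n (2 ^ n + 1 - j) = sb (Suc n) (2 ^ Suc n + 2 - k)"
      using b by (simp add: Suc_diff_le del: sb.simps)
    finally show ?thesis .
  next
    case False
    then obtain j where j: "k = 2 * j" by (auto elim: evenE)
    then have b: "1 \<le> j" "j \<le> 2 ^ n" using Suc.prems by auto
    have IH: "sb (Suc n) (2 ^ n + j) = right_pair (sb n (2 ^ n - j + 1 + 1))"
      "sb (Suc n) (2 ^ n + j + 1) = right_pair (sb n (2 ^ n - j + 1))"
      using Suc.IH[of j] Suc.IH[of "j + 1"] b by (simp_all add: Suc_diff_le del: sb.simps)
    have "2 ^ Suc n + 2 - k = 2 * (2 ^ n - j + 1)" using j b by auto
    moreover have "2 ^ Suc n + k = 2 * (2 ^ n + j)" using j by simp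
    ultimately show ?thesis
      by (simp only: sb_Suc_even IH fst_conv snd_conv prod.inject) (simp only: add_ac)
  qed
qed

text \<open>Pairs are kept because the branches act on them additively. At \<open>n = 0\<close>
  truncated subtraction yields the stray pair (1, 1), so the lemmas start at
  \<open>Suc n\<close>.\<close>

definition even_pairs :: "nat \<Rightarrow> (nat \<times> nat) set" where
  "even_pairs n = (\<lambda>k. sb n (2 * k)) ` {1..2 ^ (n - 1)}"

lemma even_pairs_1: "even_pairs (Suc 0) = {(1, 2)}"
  by (simp add: even_pairs_def numeral_2_eq_2)

lemma even_pairs_Suc:
  "even_pairs (Suc (Suc n)) = left_pair ` even_pairs (Suc n) \<union> right_pair ` even_pairs (Suc n)"
proof -
  \<comment> \<open>The upper half of the index range is listed backwards, so that the reflection in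
    \<open>sb_right_half\<close> returns to \<open>2 * k\<close>; it preserves even indices.\<close>
  have "{1..2 ^ Suc n} = {1..2 ^ n} \<union> (\<lambda>k. 2 ^ n + (2 ^ n + 1 - k)) ` {1..2 ^ n :: nat}"
  proof (intro subset_antisym subsetI)
    fix x :: nat assume "x \<in> {1..2 ^ Suc n}"
    then show "x \<in> {1..2 ^ n} \<union> (\<lambda>k. 2 ^ n + (2 ^ n + 1 - k)) ` {1..2 ^ n}"
      by (cases "x \<le> 2 ^ n") (auto intro!: image_eqI[of _ _ "2 ^ n + 1 - (x - 2 ^ n)"])
  qed auto
  moreover have "sb (Suc (Suc n)) (2 * k) = left_pair (sb (Suc n) (2 * k))"
    if "k \<in> {1..2 ^ n}" for k
    using that by (intro sb_left_half) auto
  moreover have "sb (Suc (Suc n)) (2 * (2 ^ n + (2 ^ n + 1 - k))) = right_pair (sb (Suc n) (2 * k))"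
    if "k \<in> {1..2 ^ n}" for k
  proof -
    have "2 * (2 ^ n + (2 ^ n + 1 - k)) = 2 ^ Suc n + 2 * (2 ^ n + 1 - k)"
      "2 * k = 2 ^ Suc n + 2 - 2 * (2 ^ n + 1 - k)"
      using that by auto
    moreover have "sb (Suc (Suc n)) (2 ^ Suc n + 2 * (2 ^ n + 1 - k)) =
        right_pair (sb (Suc n) (2 ^ Suc n + 2 - 2 * (2 ^ n + 1 - k)))"
      by (rule sb_right_half) (use that in auto)
    ultimately show ?thesis by (simp only:)
  qed
  ultimately show ?thesis
    by (simp add: even_pairs_def image_Un image_image del: sb.simps cong: image_cong_simp)
qed

lemma even_pairs_lowest_terms:
  assumes "x \<in> even_pairs (Suc n)"
  shows "0 < fst x \<and> fst x < snd x \<and> coprime (fst x) (snd x)"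
  using assms
proof (induction n arbitrary: x)
  case (Suc n)
  have [simp]: "gcd b (a + b) = gcd a b" for a b :: nat
    by (metis gcd_add1 gcd.commute)
  show ?case
    using Suc.prems by (auto simp: even_pairs_Suc coprime_iff_gcd_eq_1 dest!: Suc.IH)
qed (auto simp: even_pairs_1)

text \<open>Since numerators are smaller than denominators, the left images lie below 1/2 and the
  right images above, so the union is disjoint.\<close>

lemma sum_even_pairs_Suc:
  fixes g :: "nat \<times> nat \<Rightarrow> real"
  shows "sum g (even_pairs (Suc (Suc n))) =
    (\<Sum>x\<in>even_pairs (Suc n). g (left_pair x) + g (right_pair x))"
proof -
  have "left_pair x \<noteq> right_pair y" if "x \<in> even_pairs (Suc n)" "y \<in> even_pairs (Suc n)" for x y
    using even_pairs_lowest_terms[OF that(1)] even_pairs_lowest_terms[OF that(2)] by auto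
  then have "left_pair ` even_pairs (Suc n) \<inter> right_pair ` even_pairs (Suc n) = {}"
    by blast
  then have "sum g (even_pairs (Suc (Suc n))) =
      sum g (left_pair ` even_pairs (Suc n)) + sum g (right_pair ` even_pairs (Suc n))"
    unfolding even_pairs_Suc by (intro sum.union_disjoint) (auto simp: even_pairs_def)
  also have "\<dots> = (\<Sum>x\<in>even_pairs (Suc n). g (left_pair x)) + (\<Sum>x\<in>even_pairs (Suc n). g (right_pair x))"
    by (subst (1 2) sum.reindex) (auto simp: inj_on_def prod_eq_iff)
  finally show ?thesis by (simp add: sum.distrib)
qed

lemma quotient_of_fraction:
  assumes "coprime p q" "0 < q"
  shows "quotient_of (of_nat p / of_nat q) = (int p, int q)"
proof -
  have "of_nat p / of_nat q = Fract (int p) (int q)"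
    by (simp add: Fract_of_int_quotient)
  then show ?thesis
    using assms by (simp add: quotient_of_Fract normalize_stable)
qed

text \<open>Lowest terms make the passage from pairs to fractions injective and identify
  \<open>den\<close> with the second component.\<close>

lemma sum_SB_even:
  fixes f :: "real \<Rightarrow> real"
  shows "(\<Sum>x\<in>SB_even (Suc n). f (real_of_rat x) / (real_of_int (den x))\<^sup>2) =
    (\<Sum>x\<in>even_pairs (Suc n). f (fst x / snd x) / (real (snd x))\<^sup>2)"
proof -
  have q: "quotient_of (of_nat (fst x) / of_nat (snd x)) = (int (fst x), int (snd x))"
    if "x \<in> even_pairs (Suc n)" for x
    using even_pairs_lowest_terms[OF that] by (intro quotient_of_fraction) auto
  have "{g k | k. 1 \<le> k \<and> k \<le> N} = g ` {1..N}" for g :: "nat \<Rightarrow> rat" and N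
    by auto
  then have "SB_even (Suc n) = (\<lambda>x. of_nat (fst x) / of_nat (snd x)) ` even_pairs (Suc n)"
    by (simp only: SB_even_def even_pairs_def image_image)
  moreover have "inj_on (\<lambda>x. of_nat (fst x) / of_nat (snd x) :: rat) (even_pairs (Suc n))"
  proof (rule inj_onI)
    fix x y assume xy: "x \<in> even_pairs (Suc n)" "y \<in> even_pairs (Suc n)"
      "of_nat (fst x) / of_nat (snd x) = (of_nat (fst y) / of_nat (snd y) :: rat)"
    have "(int (fst x), int (snd x)) = (int (fst y), int (snd y))"
      using q[OF xy(1)] q[OF xy(2)] unfolding xy(3) by (rule trans[OF sym])
    then show "x = y" by (simp add: prod_eq_iff)
  qed
  ultimately have "(\<Sum>x\<in>SB_even (Suc n). f (real_of_rat x) / (real_of_int (den x))\<^sup>2) =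
      (\<Sum>x\<in>even_pairs (Suc n). f (real_of_rat (of_nat (fst x) / of_nat (snd x))) /
         (real_of_int (den (of_nat (fst x) / of_nat (snd x))))\<^sup>2)"
    by (simp only: sum.reindex o_def)
  also have "\<dots> = (\<Sum>x\<in>even_pairs (Suc n). f (fst x / snd x) / (real (snd x))\<^sup>2)"
    by (rule sum.cong) (simp_all add: den_def q of_rat_divide)
  finally show ?thesis .
qed

section \<open>Farey fractions by denominator, and all fractions by gcd\<close>

definition primitive_sum :: "(real \<Rightarrow> real) \<Rightarrow> nat \<Rightarrow> real" where
  "primitive_sum f d = (\<Sum>p | p \<in> {1..d} \<and> coprime p d. f (real p / real d))"

lemma sum_farey:
  fixes f :: "real \<Rightarrow> real"
  shows "(\<Sum>x\<in>farey n. f (real_of_rat x) / (real_of_int (den x))\<^sup>2) =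
    (\<Sum>d=1..n. primitive_sum f d / (real d)\<^sup>2)"
proof -
  define S where "S = (SIGMA d:{1..n}. {p. p \<in> {1..d} \<and> coprime p d})"
  define \<phi> :: "nat \<times> nat \<Rightarrow> rat" where "\<phi> = (\<lambda>(d, p). of_nat p / of_nat d)"
  have q: "quotient_of (\<phi> (d, p)) = (int p, int d)" if "(d, p) \<in> S" for d p
    using that unfolding \<phi>_def S_def by (auto intro!: quotient_of_fraction)
  have "inj_on \<phi> S"
  proof (rule inj_onI)
    fix x y assume xy: "x \<in> S" "y \<in> S" "\<phi> x = \<phi> y"
    obtain d p d' p' where dp: "x = (d, p)" "y = (d', p')" by (cases x, cases y) auto
    with xy have "(int p, int d) = (int p', int d')"
      using q by metis
    then show "x = y" by (simp add: dp)
  qed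
  have "\<phi> ` S = farey n"
  proof (intro subset_antisym subsetI)
    fix x assume "x \<in> \<phi> ` S"
    then obtain d p where dp: "(d, p) \<in> S" "x = \<phi> (d, p)" by auto
    then show "x \<in> farey n"
      using q[OF dp(1)] by (auto simp: farey_def den_def S_def \<phi>_def)
  next
    fix x assume x: "x \<in> farey n"
    obtain a b where ab: "quotient_of x = (a, b)" by (cases "quotient_of x")
    then have b: "b > 0" "coprime a b" "x = of_int a / of_int b"
      using quotient_of_denom_pos quotient_of_coprime quotient_of_div by blast+
    with x ab have "0 < a" "a \<le> b" "b \<le> int n"
      by (auto simp: farey_def den_def zero_less_divide_iff divide_le_eq)
    moreover obtain p d where "a = int p" "b = int d"
      using \<open>0 < a\<close> b(1) by (metis less_imp_le nonneg_int_cases)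
    ultimately have "(d, p) \<in> S" "x = \<phi> (d, p)"
      using b by (auto simp: S_def \<phi>_def)
    then show "x \<in> \<phi> ` S" by blast
  qed
  then have "(\<Sum>x\<in>farey n. f (real_of_rat x) / (real_of_int (den x))\<^sup>2) =
      (\<Sum>x\<in>S. f (real_of_rat (\<phi> x)) / (real_of_int (den (\<phi> x)))\<^sup>2)"
    using sum.reindex[OF \<open>inj_on \<phi> S\<close>] by (metis (no_types, lifting) o_apply sum.cong)
  also have "\<dots> = (\<Sum>(d, p)\<in>S. f (real p / real d) / (real d)\<^sup>2)"
  proof (rule sum.cong, goal_cases)
    case (2 x)
    then obtain d p where "x = (d, p)" "(d, p) \<in> S" by (cases x) auto
    then show ?case using q[of d p] by (simp add: den_def \<phi>_def of_rat_divide)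
  qed simp
  also have "\<dots> = (\<Sum>d=1..n. \<Sum>p | p \<in> {1..d} \<and> coprime p d. f (real p / real d) / (real d)\<^sup>2)"
    unfolding S_def by (rule sum.Sigma[symmetric]) auto
  finally show ?thesis by (simp add: primitive_sum_def sum_divide_distrib)
qed

text \<open>Writing \<open>q = m * d\<close> and \<open>p = m * a\<close> with
  \<open>m = gcd p q\<close> turns \<open>q \<le> n\<close> into \<open>d \<le> n div m\<close> and
  splits the weight as \<open>1 / d^2\<close> times \<open>1 / m^2\<close>.\<close>

lemma sum_fractions_by_gcd:
  fixes f :: "real \<Rightarrow> real"
  shows "(\<Sum>q=1..n. (\<Sum>p=1..q. f (real p / real q)) / (real q)\<^sup>2) =
    (\<Sum>m=1..n. (\<Sum>d=1..n div m. primitive_sum f d / (real d)\<^sup>2) / (real m)\<^sup>2)"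
proof -
  define T where "T d = {p. p \<in> {1..d} \<and> coprime p d}" for d :: nat
  have [simp]: "finite (T d)" for d by (simp add: T_def)
  have "(\<Sum>q=1..n. (\<Sum>p=1..q. f (real p / real q)) / (real q)\<^sup>2) =
      (\<Sum>(q, p)\<in>(SIGMA q:{1..n}. {1..q}). f (real p / real q) / (real q)\<^sup>2)"
    by (simp add: sum.Sigma sum_divide_distrib)
  also have "\<dots> = (\<Sum>(m, d, a)\<in>(SIGMA m:{1..n}. SIGMA d:{1..n div m}. T d).
      f (real a / real d) / (real d)\<^sup>2 / (real m)\<^sup>2)"
  proof (rule sum.reindex_bij_witness[where i = "\<lambda>(m, d, a). (m * d, m * a)"
        and j = "\<lambda>(q, p). (gcd p q, q div gcd p q, p div gcd p q)"], goal_cases)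
    case (1 x)
    then show ?case by auto
  next
    case (2 x)
    then obtain q p where x: "x = (q, p)" "1 \<le> q" "q \<le> n" "1 \<le> p" "p \<le> q" by auto
    then have "gcd p q > 0" "gcd p q \<le> q"
      using gcd_le2_nat[of q p] by auto
    moreover from this x have "gcd p q \<le> n" by linarith
    ultimately show ?case using x
      by (auto simp: T_def div_le_mono dvd_imp_le Suc_le_eq div_greater_zero_iff
          intro!: div_gcd_coprime gcd_le1_nat)
  next
    case (3 x)
    then obtain m d a where x: "x = (m, d, a)" "1 \<le> m" "1 \<le> d" "coprime a d"
      by (auto simp: T_def)
    then have "gcd (m * a) (m * d) = m" by (simp add: gcd_mult_distrib_nat[symmetric])
    with x show ?case by simp
  next
    case (4 x)
    then obtain m d a where x: "x = (m, d, a)" "1 \<le> m" "m \<le> n" "1 \<le> d" "d \<le> n div m"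
      "1 \<le> a" "a \<le> d" by (auto simp: T_def)
    then have "m * d \<le> n" using less_eq_div_iff_mult_less_eq[of m d n] by (simp add: mult.commute)
    with x show ?case by auto
  next
    case (5 x)
    then obtain q p where x: "x = (q, p)" "1 \<le> q" "1 \<le> p" by auto
    define g where "g = gcd p q"
    have "g dvd p" "g dvd q" "g > 0" using x by (auto simp: g_def)
    then obtain a d where ad: "p = g * a" "q = g * d" by (auto elim!: dvdE)
    have "gcd (g * a) (g * d) = g" using g_def unfolding ad by (rule sym)
    then show ?case using x \<open>g > 0\<close>
      by (simp add: ad power_mult_distrib mult.commute[of "(real g)\<^sup>2"])
  qed
  also have "\<dots> = (\<Sum>m=1..n. \<Sum>d=1..n div m. \<Sum>a\<in>T d. f (real a / real d) / (real d)\<^sup>2 / (real m)\<^sup>2)"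
    by (simp add: sum.Sigma)
  also have "\<dots> = (\<Sum>m=1..n. (\<Sum>d=1..n div m. primitive_sum f d / (real d)\<^sup>2) / (real m)\<^sup>2)"
    by (simp add: primitive_sum_def T_def sum_divide_distrib)
  finally show ?thesis .
qed

subsection \<open>Logarithmic means and the Farey sequence\<close>

lemma harm_le_ln: "n > 0 \<Longrightarrow> harm n \<le> ln (real n) + 1"
proof (induction n rule: nat_induct_non_zero)
  case 1
  then show ?case by (simp add: harm_expand)
next
  case (Suc n)
  have "ln (real n / real (Suc n)) \<le> real n / real (Suc n) - 1"
    using Suc.hyps by (intro ln_le_minus_one) auto
  then have "inverse (real (Suc n)) \<le> ln (real (Suc n)) - ln (real n)"
    using Suc.hyps by (simp add: ln_div field_simps)
  with Suc.IH show ?case by (simp add: harm_Suc)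
qed

text \<open>Cesaro's argument with weights \<open>1 / q\<close>, whose total \<open>harm n\<close>
  differs from \<open>ln n\<close> by at most 1.\<close>

lemma logarithmic_mean_tendsto:
  fixes a :: "nat \<Rightarrow> real"
  assumes "a \<longlonglongrightarrow> L"
  shows "(\<lambda>n. (\<Sum>q=1..n. a q / q) / ln n) \<longlonglongrightarrow> L"
proof (rule LIMSEQ_I)
  fix e :: real assume e: "e > 0"
  obtain N where N: "\<And>q. q \<ge> N \<Longrightarrow> \<bar>a q - L\<bar> < e / 2"
    using LIMSEQ_D[OF assms, of "e / 2"] e by auto
  define K where "K = (\<Sum>q=1..N. \<bar>a q - L\<bar> / q)"
  \<comment> \<open>The three terms bound the indices up to \<open>N\<close>, the later indices, and
    the replacement of \<open>harm n\<close> by \<open>ln n\<close>.\<close>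
  have "\<forall>\<^sub>F n in sequentially. (K + e / 2 * (ln (real n) + 1) + \<bar>L\<bar>) / ln n < e"
    using e by real_asymp
  moreover have "\<forall>\<^sub>F n in sequentially. ln (real n) > 0" by real_asymp
  ultimately have "\<forall>\<^sub>F n in sequentially. norm ((\<Sum>q=1..n. a q / q) / ln n - L) < e"
    using eventually_ge_at_top[of "max 1 N"]
  proof eventually_elim
    case (elim n)
    then have n: "n \<ge> 1" "n \<ge> N" by auto
    have "\<bar>\<Sum>q=1..n. (a q - L) / q\<bar> \<le> (\<Sum>q=1..n. \<bar>a q - L\<bar> / q)"
      by (rule order_trans[OF sum_abs]) simp
    also have "\<dots> \<le> (\<Sum>q=1..n. (if q \<le> N then \<bar>a q - L\<bar> / q else 0) + e / 2 * inverse (real q))"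
      using N e by (intro sum_mono) (auto simp: field_simps less_imp_le)
    also have "\<dots> = (\<Sum>q=1..n. if q \<le> N then \<bar>a q - L\<bar> / q else 0) + e / 2 * harm n"
      by (simp add: sum.distrib harm_def sum_distrib_left)
    also have "(\<Sum>q=1..n. if q \<le> N then \<bar>a q - L\<bar> / q else 0) = K"
      unfolding K_def using n by (intro sum.mono_neutral_cong_right) auto
    finally have 1: "\<bar>\<Sum>q=1..n. (a q - L) / q\<bar> \<le> K + e / 2 * harm n" .
    have "ln (real n) \<le> ln (real n + 1)" using n by simp
    then have "\<bar>harm n - ln (real n)\<bar> \<le> 1"
      using harm_le_ln[of n] ln_le_harm[of n] n by linarith
    then have 2: "\<bar>L * (harm n - ln n)\<bar> \<le> \<bar>L\<bar>"
      by (simp add: abs_mult mult_left_le)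
    have 3: "e / 2 * harm n \<le> e / 2 * (ln n + 1)"
      using harm_le_ln[of n] n e by (intro mult_left_mono) auto
    have "(\<Sum>q=1..n. a q / q) - L * ln n = (\<Sum>q=1..n. (a q - L) / q) + L * (harm n - ln n)"
    proof -
      have "(\<Sum>q=1..n. a q / q) = (\<Sum>q=1..n. (a q - L) / q + L * inverse (real q))"
        by (intro sum.cong) (simp_all add: divide_inverse left_diff_distrib)
      then show ?thesis by (simp add: sum.distrib harm_def sum_distrib_left right_diff_distrib)
    qed
    then have "\<bar>(\<Sum>q=1..n. a q / q) - L * ln n\<bar> \<le> K + e / 2 * (ln n + 1) + \<bar>L\<bar>"
      using 1 2 3 by linarith
    then have "\<bar>(\<Sum>q=1..n. a q / q) - L * ln n\<bar> / ln n < e"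
      using elim by (meson divide_right_mono le_less_trans less_imp_le)
    moreover have "(\<Sum>q=1..n. a q / q) / ln n - L = ((\<Sum>q=1..n. a q / q) - L * ln n) / ln n"
      using elim by (simp add: field_simps)
    ultimately show ?case using elim by (simp add: abs_divide)
  qed
  then show "\<exists>no. \<forall>n\<ge>no. norm ((\<Sum>q=1..n. a q / q) / ln n - L) < e"
    by (simp add: eventually_sequentially)
qed

lemma riemann_sum_tendsto:
  fixes f :: "real \<Rightarrow> real"
  assumes f: "continuous_on {0..1} f"
  shows "(\<lambda>q. (\<Sum>p=1..q. f (real p / real q)) / q) \<longlonglongrightarrow> integral {0..1} f"
proof (rule LIMSEQ_I)
  fix e :: real assume e: "e > 0"
  have "uniformly_continuous_on {0..1} f"
    using f by (intro compact_uniformly_continuous) auto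
  then obtain d where d: "d > 0"
    "\<And>x y. x \<in> {0..1} \<Longrightarrow> y \<in> {0..1} \<Longrightarrow> dist x y < d \<Longrightarrow> dist (f x) (f y) < e / 2"
    unfolding uniformly_continuous_on_def by (metis e half_gt_zero)
  have int: "f integrable_on {a..b}" if "0 \<le> a" "b \<le> 1" for a b
    by (intro integrable_continuous_interval continuous_on_subset[OF f]) (use that in auto)
  have "\<forall>\<^sub>F q in sequentially. 1 / real q < d" using d(1) by real_asymp
  then have "\<forall>\<^sub>F q in sequentially. norm ((\<Sum>p=1..q. f (real p / real q)) / q - integral {0..1} f) < e"
    using eventually_gt_at_top[of 0]
  proof eventually_elim
    case (elim q)
    \<comment> \<open>The error is accumulated cell by cell: by uniform continuity each cell of
      length \<open>1 / q\<close> adds at most \<open>e / 2 * (1 / q)\<close>.\<close>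
    have "\<bar>(\<Sum>p=1..k. f (real p / real q)) / q - integral {0..k/q} f\<bar> \<le> e / 2 * (k / q)" if "k \<le> q" for k
      using that
    proof (induction k)
      case (Suc k)
      have k: "0 \<le> k / q" "k / q \<le> Suc k / q" "Suc k / q \<le> 1"
        using Suc.prems elim by (auto simp: divide_right_mono)
      have len: "Suc k / q - k / q = 1 / q"
        by (simp add: diff_divide_distrib[symmetric])
      have "integral {k/q..Suc k/q} (\<lambda>x. f x - f (Suc k / q)) =
          integral {k/q..Suc k/q} f - integral {k/q..Suc k/q} (\<lambda>_. f (Suc k / q))"
        by (rule integral_diff) (use int k in auto)
      also have "integral {k/q..Suc k/q} (\<lambda>_. f (Suc k / q)) = f (Suc k / q) / q"
        using k len by simp
      finally have "integral {k/q..Suc k/q} f - f (Suc k / q) / q =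
          integral {k/q..Suc k/q} (\<lambda>x. f x - f (Suc k / q))" by simp
      moreover have "norm (integral {k/q..Suc k/q} (\<lambda>x. f x - f (Suc k / q))) \<le>
          integral {k/q..Suc k/q} (\<lambda>_. e / 2)"
      proof (rule integral_norm_bound_integral)
        show "(\<lambda>x. f x - f (Suc k / q)) integrable_on {k/q..Suc k/q}"
          by (rule integrable_diff) (use int k in auto)
        fix x assume x: "x \<in> {k/q..Suc k/q}"
        then have "0 \<le> x" "x \<le> 1" using k by (meson atLeastAtMost_iff order_trans)+
        then have "x \<in> {0..1}" "Suc k / q \<in> {0..1}" using k by auto
        moreover have "dist x (Suc k / q) < d"
          using x len elim by (auto simp: dist_real_def)
        ultimately show "norm (f x - f (Suc k / q)) \<le> e / 2"
          using d(2) by (force simp: dist_norm less_imp_le)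
      qed auto
      moreover have "integral {k/q..Suc k/q} (\<lambda>_. e / 2) = e / 2 * (1 / q)"
        using k len by simp
      ultimately have 1: "\<bar>integral {k/q..Suc k/q} f - f (Suc k / q) / q\<bar> \<le> e / 2 * (1 / q)"
        by simp
      have 2: "integral {0..k/q} f + integral {k/q..Suc k/q} f = integral {0..Suc k/q} f"
        by (rule Henstock_Kurzweil_Integration.integral_combine) (use k int in auto)
      have 3: "(\<Sum>p=1..Suc k. f (real p / real q)) / q = (\<Sum>p=1..k. f (real p / real q)) / q + f (Suc k / q) / q"
        by (simp add: add_divide_distrib)
      have 4: "e / 2 * (Suc k / q) = e / 2 * (k / q) + e / 2 * (1 / q)"
        by (simp add: add_divide_distrib distrib_left)
      show ?case using Suc.IH Suc.prems 1 2 3 4 by linarith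
    qed simp
    from this[of q] show ?case using elim e by simp
  qed
  then show "\<exists>no. \<forall>q\<ge>no. norm ((\<Sum>p=1..q. f (real p / real q)) / q - integral {0..1} f) < e"
    by (simp add: eventually_sequentially)
qed

section \<open>The constant zeta(2) and the passage to reduced fractions\<close>

lemma zeta2_tendsto: "(\<lambda>n. \<Sum>m=1..n. 1 / (real m)\<^sup>2) \<longlonglongrightarrow> zeta2" and zeta2_pos: "zeta2 > 0"
proof -
  have "summable (\<lambda>n. 1 / (real n)\<^sup>2)"
    using inverse_power_summable[of 2, where 'a = real] by (simp add: inverse_eq_divide)
  then have s: "summable (\<lambda>k. 1 / (real (Suc k))\<^sup>2)"
    by (subst summable_Suc_iff)
  have "(\<Sum>m=1..n. 1 / (real m)\<^sup>2) = (\<Sum>k<n. 1 / (real (Suc k))\<^sup>2)" for n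
    by (induction n) auto
  then show "(\<lambda>n. \<Sum>m=1..n. 1 / (real m)\<^sup>2) \<longlonglongrightarrow> zeta2"
    using summable_LIMSEQ[OF s] by (simp add: zeta2_def)
  show "zeta2 > 0"
    unfolding zeta2_def by (rule suminf_pos[OF s]) simp
qed

lemma abs_primitive_sum_le:
  assumes "\<And>x. x \<in> {0..1} \<Longrightarrow> \<bar>f x\<bar> \<le> C" "d > 0"
  shows "\<bar>primitive_sum f d\<bar> \<le> C * d"
proof -
  have "0 \<le> C" using assms(1)[of 0] by simp
  have "\<bar>primitive_sum f d\<bar> \<le> (\<Sum>p | p \<in> {1..d} \<and> coprime p d. \<bar>f (real p / real d)\<bar>)"
    unfolding primitive_sum_def by (rule sum_abs)
  also have "\<dots> \<le> (\<Sum>p | p \<in> {1..d} \<and> coprime p d. C)"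
    by (intro sum_mono assms(1)) auto
  also have "\<dots> \<le> (\<Sum>p=1..d. C)"
    using \<open>0 \<le> C\<close> by (intro sum_mono2) auto
  finally show ?thesis by (simp add: mult.commute)
qed

text \<open>Passing from \<open>n\<close> to \<open>n div m\<close> changes the partial sums only by \<open>O(1 + ln m)\<close>; summed against
  \<open>1 / m\<^sup>2\<close> this is negligible, so no Moebius inversion is needed.\<close>

lemma primitive_sums_tendsto:
  fixes f :: "real \<Rightarrow> real"
  assumes f: "continuous_on {0..1} f"
  shows "(\<lambda>n. zeta2 / ln n * (\<Sum>d=1..n. primitive_sum f d / (real d)\<^sup>2)) \<longlonglongrightarrow> integral {0..1} f"
proof -
  have "bounded (f ` {0..1})"
    by (intro compact_imp_bounded compact_continuous_image f) auto
  then obtain C where C: "\<And>x. x \<in> {0..1} \<Longrightarrow> \<bar>f x\<bar> \<le> C"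
    unfolding bounded_iff by (metis imageI real_norm_def)
  have "0 \<le> C" using C[of 0] by simp
  \<comment> \<open>\<open>A\<close> runs over reduced fractions and \<open>B\<close> over all
    fractions; \<open>E\<close> will bound the error in replacing \<open>B\<close> by the product
    \<open>A * Z\<close>.\<close>
  define A where "A n = (\<Sum>d=1..n. primitive_sum f d / (real d)\<^sup>2)" for n
  define B where "B n = (\<Sum>q=1..n. (\<Sum>p=1..q. f (real p / real q)) / (real q)\<^sup>2)" for n
  define Z where "Z n = (\<Sum>m=1..n. 1 / (real m)\<^sup>2)" for n
  define E where "E n = (\<Sum>m=1..n. (C * (ln (real m) + 1) / real m) / real m)" for n
  have A_diff: "\<bar>A n - A (n div m)\<bar> \<le> C * (ln m + 1)" if m: "m \<in> {1..n}" for m n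
  proof -
    have split: "{1..n} = {1..n div m} \<union> {n div m<..n}" "{1..n div m} \<inter> {n div m<..n} = {}"
      by (auto intro: order_trans[OF _ div_le_dividend])
    have S: "sum g {1..n} = sum g {1..n div m} + sum g {n div m<..n}" for g :: "nat \<Rightarrow> real"
      by (subst split(1), rule sum.union_disjoint) (use split(2) in auto)
    have "\<bar>A n - A (n div m)\<bar> = \<bar>\<Sum>d\<in>{n div m<..n}. primitive_sum f d / (real d)\<^sup>2\<bar>"
      unfolding A_def S by simp
    also have "\<dots> \<le> (\<Sum>d\<in>{n div m<..n}. \<bar>primitive_sum f d / (real d)\<^sup>2\<bar>)"
      by (rule sum_abs)
    also have "\<dots> \<le> (\<Sum>d\<in>{n div m<..n}. C * inverse (real d))"
    proof (rule sum_mono)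
      fix d assume "d \<in> {n div m<..n}"
      then have "d > 0" by auto
      then show "\<bar>primitive_sum f d / (real d)\<^sup>2\<bar> \<le> C * inverse (real d)"
        using abs_primitive_sum_le[OF C] by (simp add: abs_divide field_simps power2_eq_square)
    qed
    also have "\<dots> = C * (harm n - harm (n div m))"
      using S[of "\<lambda>d. inverse (real d)"] by (simp add: harm_def sum_distrib_left)
    also have "\<dots> \<le> C * (ln m + 1)"
    proof (rule mult_left_mono[OF _ \<open>0 \<le> C\<close>])
      \<comment> \<open>The added 1 absorbs the rounding in \<open>n div m\<close> and matches the
        form of \<open>ln_le_harm\<close>.\<close>
      have "n < m * (n div m + 1)"
        using m dividend_less_times_div[of m n] by simp
      then have "real n \<le> real m * (real (n div m) + 1)"
        by (metis of_nat_1 of_nat_add of_nat_le_iff of_nat_mult less_imp_le)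
      then have "ln (real n) \<le> ln (real m * (real (n div m) + 1))"
        using m by (intro ln_mono) auto
      also have "\<dots> = ln m + ln (real (n div m) + 1)"
        using m by (intro ln_mult_pos) auto
      finally have "ln (real n) \<le> ln m + ln (real (n div m) + 1)" .
      then show "harm n - harm (n div m) \<le> ln m + 1"
        using harm_le_ln[of n] ln_le_harm[of "n div m"] m by auto
    qed
    finally show ?thesis .
  qed
  have A_B: "\<bar>A n * Z n - B n\<bar> \<le> E n" for n
  proof -
    have "B n = (\<Sum>m=1..n. A (n div m) / (real m)\<^sup>2)"
      unfolding A_def B_def by (rule sum_fractions_by_gcd)
    then have "A n * Z n - B n = (\<Sum>m=1..n. (A n - A (n div m)) / (real m)\<^sup>2)"
      by (simp add: Z_def sum_distrib_left sum_subtractf diff_divide_distrib)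
    also have "\<bar>\<dots>\<bar> \<le> (\<Sum>m=1..n. \<bar>(A n - A (n div m)) / (real m)\<^sup>2\<bar>)"
      by (rule sum_abs)
    also have "\<dots> \<le> E n"
      unfolding E_def
      by (intro sum_mono) (use A_diff in \<open>auto simp: abs_divide power2_eq_square divide_right_mono\<close>)
    finally show ?thesis .
  qed
  \<comment> \<open>\<open>E n / ln n\<close> is the logarithmic mean of this null sequence.\<close>
  have "(\<lambda>m. C * (ln (real m) + 1) / m) \<longlonglongrightarrow> 0" by real_asymp
  then have E0: "(\<lambda>n. E n / ln n) \<longlonglongrightarrow> 0"
    unfolding E_def by (rule logarithmic_mean_tendsto)
  have B: "(\<lambda>n. B n / ln n) \<longlonglongrightarrow> integral {0..1} f"
    using logarithmic_mean_tendsto[OF riemann_sum_tendsto[OF f]]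
    by (simp add: B_def power2_eq_square)
  have "(\<lambda>n. (A n * Z n - B n) / ln n) \<longlonglongrightarrow> 0"
  proof (rule Lim_null_comparison[OF _ E0])
    show "\<forall>\<^sub>F n in sequentially. norm ((A n * Z n - B n) / ln n) \<le> E n / ln n"
      using eventually_gt_at_top[of 0]
      by eventually_elim (use A_B in \<open>auto simp: abs_divide divide_right_mono\<close>)
  qed
  from tendsto_add[OF this B]
  have "(\<lambda>n. A n * Z n / ln n) \<longlonglongrightarrow> integral {0..1} f"
    by (simp add: diff_divide_distrib)
  moreover have Z: "Z \<longlonglongrightarrow> zeta2"
    using zeta2_tendsto by (simp add: Z_def[abs_def])
  ultimately have "(\<lambda>n. zeta2 * (A n * Z n / ln n / Z n)) \<longlonglongrightarrow> zeta2 * (integral {0..1} f / zeta2)"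
    using zeta2_pos by (intro tendsto_intros) auto
  moreover have "\<forall>\<^sub>F n in sequentially. zeta2 * (A n * Z n / ln n / Z n) = zeta2 / ln n * A n"
    using order_tendstoD(1)[OF Z zeta2_pos] by eventually_elim simp
  ultimately show ?thesis
    using zeta2_pos unfolding A_def[symmetric] by (simp add: Lim_transform_eventually)
qed

subsection \<open>From monomials to continuous functions\<close>

text \<open>The first row is the single fraction 1/2, the image of 1 under both branches. Peeling
  off the last level of the tree replaces \<open>f\<close> by \<open>farey_transfer f\<close>, hence
  the induction over arbitrary \<open>f\<close>.\<close>

lemma sum_even_pairs_funpow:
  "(\<Sum>x\<in>even_pairs (Suc n). f (fst x / snd x) / (real (snd x))\<^sup>2) =
     (farey_transfer ^^ Suc n) f 1 / 2"
proof (induction n arbitrary: f)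
  case 0
  show ?case by (simp add: even_pairs_1 farey_transfer_def)
next
  case (Suc n)
  have "(\<Sum>x\<in>even_pairs (Suc (Suc n)). f (fst x / snd x) / (real (snd x))\<^sup>2) =
      (\<Sum>x\<in>even_pairs (Suc n). farey_transfer f (fst x / snd x) / (real (snd x))\<^sup>2)"
    unfolding sum_even_pairs_Suc
  proof (rule sum.cong[OF refl])
    fix x assume "x \<in> even_pairs (Suc n)"
    then have st: "0 < fst x" "0 < snd x" using even_pairs_lowest_terms[of x n] by auto
    define s t where "s = real (fst x)" and "t = real (snd x)"
    have "s > 0" "t > 0" using st by (auto simp: s_def t_def)
    then have eq: "s / t / (1 + s / t) = s / (s + t)" "1 / (1 + s / t) = t / (s + t)"
      "(1 + s / t)\<^sup>2 * t\<^sup>2 = (s + t)\<^sup>2"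
      by (auto simp: field_simps power2_eq_square)
    have "farey_transfer f (s / t) / t\<^sup>2 =
        (f (s / t / (1 + s / t)) + f (1 / (1 + s / t))) / ((1 + s / t)\<^sup>2 * t\<^sup>2)"
      by (simp only: farey_transfer_def divide_divide_eq_left)
    also have "\<dots> =
        f (s / (s + t)) / (s + t)\<^sup>2 + f (t / (s + t)) / (s + t)\<^sup>2"
      by (simp only: eq add_divide_distrib)
    finally show "f (fst (left_pair x) / snd (left_pair x)) / (real (snd (left_pair x)))\<^sup>2 +
        f (fst (right_pair x) / snd (right_pair x)) / (real (snd (right_pair x)))\<^sup>2 =
        farey_transfer f (fst x / snd x) / (real (snd x))\<^sup>2"
      by (simp add: s_def t_def)
  qed
  also have "\<dots> = (farey_transfer ^^ Suc n) (farey_transfer f) 1 / 2" by (rule Suc.IH)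
  finally show ?case by (simp only: funpow_Suc_right o_apply)
qed

text \<open>The factor 2 from the logarithm of \<open>n^2\<close> cancels the one half in
  \<open>sum_even_pairs_funpow\<close>.\<close>

lemma SB_even_sum_eq_funpow:
  assumes "n > 0"
  shows "ln (real n ^ 2) * (\<Sum>x\<in>SB_even n. f (real_of_rat x) / (real_of_int (den x))\<^sup>2) =
    (farey_transfer ^^ n) f 1 * ln n"
proof -
  obtain m where m: "n = Suc m" using assms gr0_conv_Suc by blast
  have "ln (real n ^ 2) = 2 * ln (real n)" using assms by (simp add: ln_realpow)
  moreover have "2 * l * (v / 2) = v * l" for l v :: real by simp
  ultimately show ?thesis
    unfolding m by (simp only: sum_SB_even sum_even_pairs_funpow)
qed

text \<open>\<open>x * x ^ k\<close> has second derivative at most \<open>k * (k + 1)\<close> on the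
  unit interval. The added term, multiplied by \<open>x\<close>, has second derivative
  \<open>- k * (k + 1)\<close> and a derivative that is nonnegative up to 1.\<close>

lemma concave_weight_power:
  "concave_weight (\<lambda>x. x ^ k + real (k * (k + 1)) * (1 - x / 2))"
proof
  show "increasing_concave (\<lambda>x. x * (x ^ k + real (k * (k + 1)) * (1 - x / 2)))"
    unfolding increasing_concave_def
  proof (rule exI[of _ "\<lambda>x. real (k + 1) * x ^ k + real (k * (k + 1)) * (1 - x)"],
      \<comment> \<open>For \<open>k = 0\<close> the truncated exponent \<open>k - 1\<close> is
        harmless, as the coefficient vanishes.\<close>
      rule exI[of _ "\<lambda>x. real (k * (k + 1)) * (x ^ (k - 1) - 1)"], intro ballI conjI)
    fix x :: real assume x: "x \<in> {0..1}"
    have pow: "((\<lambda>x. x ^ (k + 1)) has_real_derivative real (k + 1) * x ^ k) (at x)"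
      using DERIV_pow[of "k + 1" x] by simp
    have "((\<lambda>x. x ^ (k + 1) + real (k * (k + 1)) * (x - x\<^sup>2 / 2)) has_real_derivative
        real (k + 1) * x ^ k + real (k * (k + 1)) * (1 - x)) (at x)"
      by (rule DERIV_add[OF pow DERIV_cmult]) (auto intro!: derivative_eq_intros)
    also have "(\<lambda>x::real. x ^ (k + 1) + real (k * (k + 1)) * (x - x\<^sup>2 / 2)) =
        (\<lambda>x. x * (x ^ k + real (k * (k + 1)) * (1 - x / 2)))"
      by (simp add: fun_eq_iff power2_eq_square algebra_simps)
    finally show "((\<lambda>x. x * (x ^ k + real (k * (k + 1)) * (1 - x / 2))) has_real_derivative
        real (k + 1) * x ^ k + real (k * (k + 1)) * (1 - x)) (at x)" .
    show "((\<lambda>x. real (k + 1) * x ^ k + real (k * (k + 1)) * (1 - x)) has_real_derivative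
        real (k * (k + 1)) * (x ^ (k - 1) - 1)) (at x)"
      by (auto intro!: derivative_eq_intros simp: algebra_simps)
    show "0 \<le> real (k + 1) * x ^ k + real (k * (k + 1)) * (1 - x)"
      using x by (intro add_nonneg_nonneg mult_nonneg_nonneg) auto
    have "x ^ (k - 1) \<le> 1" using x by (simp add: power_le_one)
    then show "real (k * (k + 1)) * (x ^ (k - 1) - 1) \<le> 0"
      by (intro mult_nonneg_nonpos) auto
  qed
qed (auto intro!: continuous_intros)

lemma concave_weight_linear: "concave_weight (\<lambda>x. 1 - x / 2)"
proof
  show "increasing_concave (\<lambda>x. x * (1 - x / 2))"
    unfolding increasing_concave_def
    by (rule exI[of _ "\<lambda>x. 1 - x"], rule exI[of _ "\<lambda>x. -1"])
      (auto intro!: derivative_eq_intros)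
qed (auto intro!: continuous_intros)

lemma funpow_farey_transfer_power_tendsto:
  "(\<lambda>n. (farey_transfer ^^ n) (\<lambda>x. x ^ k) 1 * ln n) \<longlonglongrightarrow> integral {0..1} (\<lambda>x. x ^ k)"
proof -
  define A where "A = real (k * (k + 1))"
  define g where "g = (\<lambda>x::real. x ^ k + A * (1 - x / 2))"
  define h where "h = (\<lambda>x::real. 1 - x / 2)"
  interpret g: concave_weight g unfolding g_def A_def by (rule concave_weight_power)
  interpret h: concave_weight h unfolding h_def by (rule concave_weight_linear)
  have eq: "(\<lambda>x. x ^ k) = (\<lambda>x. 1 * g x + (- A) * h x)"
    by (simp add: g_def h_def)
  have "((\<lambda>x. 1 * g x + (- A) * h x) has_integral (1 * integral {0..1} g + (- A) * integral {0..1} h)) {0..1}"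
    by (intro has_integral_add has_integral_mult_right integrable_integral
        integrable_continuous_interval g.cont h.cont)
  moreover have "(\<lambda>n. 1 * ((farey_transfer ^^ n) g 1 * ln n) + (- A) * ((farey_transfer ^^ n) h 1 * ln n))
      \<longlonglongrightarrow> 1 * integral {0..1} g + (- A) * integral {0..1} h"
    by (intro tendsto_intros g.u_mult_ln_tendsto h.u_mult_ln_tendsto)
  ultimately show ?thesis
    unfolding eq funpow_farey_transfer_linear
    by (simp only: integral_unique) (simp add: algebra_simps)
qed

lemma funpow_farey_transfer_sum:
  fixes N :: nat
  shows "(farey_transfer ^^ n) (\<lambda>x. \<Sum>i\<le>N. a i * g i x) = (\<lambda>x. \<Sum>i\<le>N. a i * (farey_transfer ^^ n) (g i) x)"
proof (induction N)
  case 0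
  show ?case using funpow_farey_transfer_linear[of n "a 0" "g 0" 0 "g 0"] by simp
next
  case (Suc N)
  show ?case
    using funpow_farey_transfer_linear[of n 1 "\<lambda>x. \<Sum>i\<le>N. a i * g i x" "a (Suc N)" "g (Suc N)"] Suc
    by (simp add: fun_eq_iff)
qed

lemma funpow_farey_transfer_polynomial_tendsto:
  assumes "real_polynomial_function f"
  shows "(\<lambda>n. (farey_transfer ^^ n) f 1 * ln n) \<longlonglongrightarrow> integral {0..1} f"
proof -
  obtain a N where f: "f = (\<lambda>x. \<Sum>i\<le>N. a i * x ^ i)"
    using assms by (auto simp: real_polynomial_function_iff_sum)
  have "(f has_integral (\<Sum>i\<le>N. a i * integral {0..1} (\<lambda>x. x ^ i))) {0..1}"
    unfolding f by (intro has_integral_sum has_integral_mult_right integrable_integral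
        integrable_continuous_interval continuous_intros) auto
  moreover have "(\<lambda>n. \<Sum>i\<le>N. a i * ((farey_transfer ^^ n) (\<lambda>x. x ^ i) 1 * ln n)) \<longlonglongrightarrow>
      (\<Sum>i\<le>N. a i * integral {0..1} (\<lambda>x. x ^ i))"
    by (intro tendsto_intros funpow_farey_transfer_power_tendsto)
  ultimately show ?thesis
    unfolding f funpow_farey_transfer_sum
    by (simp only: integral_unique sum_distrib_right mult.assoc)
qed

text \<open>\<open>farey_transfer\<close> is positive, so a uniform bound propagates through
  comparison with a constant function.\<close>

lemma abs_funpow_farey_transfer_le:
  assumes "\<And>x. x \<in> {0..1} \<Longrightarrow> \<bar>f x\<bar> \<le> e" "x \<in> {0..1}"
  shows "\<bar>(farey_transfer ^^ n) f x\<bar> \<le> e * (farey_transfer ^^ n) (\<lambda>_. 1) x"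
  using assms(2)
proof (induction n arbitrary: x)
  case (Suc n)
  let ?F = "(farey_transfer ^^ n) f" and ?O = "(farey_transfer ^^ n) (\<lambda>_. 1)"
  have "x / (1 + x) \<in> {0..1}" "1 / (1 + x) \<in> {0..1}"
    using Suc.prems by (auto simp: field_simps)
  from Suc.IH[OF this(1)] Suc.IH[OF this(2)]
  have "\<bar>?F (x / (1 + x)) + ?F (1 / (1 + x))\<bar> \<le> e * (?O (x / (1 + x)) + ?O (1 / (1 + x)))"
    by (simp add: distrib_left)
  then show ?case
    by (simp add: farey_transfer_def[of _ x] abs_divide divide_right_mono)
qed (use assms(1) in simp)

text \<open>A uniform error of \<open>e / 4\<close> in the polynomial approximation is multiplied by
  the sequence of the constant function 1, which tends to 1 and so is eventually below 2. The budget
  is \<open>e / 2\<close> for this, \<open>e / 4\<close> for the integrals and \<open>e / 4\<close>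
  for the polynomial limit.\<close>

lemma funpow_farey_transfer_tendsto:
  assumes f: "continuous_on {0..1} f"
  shows "(\<lambda>n. (farey_transfer ^^ n) f 1 * ln n) \<longlonglongrightarrow> integral {0..1} f"
proof (rule LIMSEQ_I)
  fix e :: real assume e: "e > 0"
  let ?L = "\<lambda>f n. (farey_transfer ^^ n) f 1 * ln (real n)"
  obtain g where g: "real_polynomial_function g" "\<And>x. x \<in> {0..1} \<Longrightarrow> \<bar>f x - g x\<bar> < e / 4"
    by (rule Stone_Weierstrass_real_polynomial_function[OF _ f, of "e / 4"]) (use e in auto)
  have g_cont: "continuous_on {0..1} g"
    using g(1) by (simp add: real_polynomial_function_eq continuous_on_polymonial_function)
  have "norm (integral {0..1} (\<lambda>x. f x - g x)) \<le> integral {0..1} (\<lambda>_::real. e / 4)"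
    by (rule integral_norm_bound_integral)
      (use g in \<open>auto intro!: integrable_continuous_interval continuous_intros f g_cont simp: less_imp_le\<close>)
  moreover have "integral {0..1} (\<lambda>x. f x - g x) = integral {0..1} f - integral {0..1} g"
    by (intro integral_diff integrable_continuous_interval f g_cont)
  ultimately have int: "\<bar>integral {0..1} f - integral {0..1} g\<bar> \<le> e / 4" by simp
  have "\<forall>\<^sub>F n in sequentially. \<bar>?L g n - integral {0..1} g\<bar> < e / 4"
    using tendstoD[OF funpow_farey_transfer_polynomial_tendsto[OF g(1)], of "e / 4"] e
    by (simp add: dist_real_def)
  moreover have "(\<lambda>n. ?L (\<lambda>_. 1) n) \<longlonglongrightarrow> 1"
    using funpow_farey_transfer_power_tendsto[of 0] by simp
  then have "\<forall>\<^sub>F n in sequentially. ?L (\<lambda>_. 1) n < 2"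
    by (rule order_tendstoD) simp
  ultimately have "\<forall>\<^sub>F n in sequentially. norm (?L f n - integral {0..1} f) < e"
    using eventually_gt_at_top[of 0]
  proof eventually_elim
    case (elim n)
    have "\<bar>(farey_transfer ^^ n) (\<lambda>x. f x - g x) 1\<bar> \<le> e / 4 * (farey_transfer ^^ n) (\<lambda>_. 1) 1"
      by (rule abs_funpow_farey_transfer_le) (use g(2) in \<open>auto simp: less_imp_le\<close>)
    moreover have "(farey_transfer ^^ n) (\<lambda>x. f x - g x) 1 = (farey_transfer ^^ n) f 1 - (farey_transfer ^^ n) g 1"
      using funpow_farey_transfer_linear[of n 1 f "-1" g] by (simp add: fun_eq_iff)
    ultimately have "\<bar>(farey_transfer ^^ n) f 1 - (farey_transfer ^^ n) g 1\<bar> * ln n \<le>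
        e / 4 * (farey_transfer ^^ n) (\<lambda>_. 1) 1 * ln n"
      using elim by (intro mult_right_mono) auto
    also have "\<dots> = e / 4 * ?L (\<lambda>_. 1) n" by simp
    also have "\<dots> \<le> e / 4 * 2" using elim e by (intro mult_left_mono) auto
    finally have "\<bar>(farey_transfer ^^ n) f 1 - (farey_transfer ^^ n) g 1\<bar> * ln n \<le> e / 2" by simp
    moreover have "\<bar>?L f n - ?L g n\<bar> = \<bar>(farey_transfer ^^ n) f 1 - (farey_transfer ^^ n) g 1\<bar> * ln n"
      using elim by (simp add: abs_mult flip: left_diff_distrib)
    ultimately have "\<bar>?L f n - ?L g n\<bar> \<le> e / 2" by simp
    then show ?case using elim(1) int unfolding real_norm_def by linarith
  qed
  then show "\<exists>no. \<forall>n\<ge>no. norm (?L f n - integral {0..1} f) < e"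
    by (simp add: eventually_sequentially)
qed

theorem theorem1p1:
  fixes f :: "real \<Rightarrow> real"
  assumes "continuous_on {0..1} f"
  shows "(\<lambda>n. ln (real n ^ 2) * (\<Sum>x\<in>SB_even n. f (real_of_rat x) / (real_of_int (den x))^2))
            \<longlonglongrightarrow> integral {0..1} f
       \<and> (\<lambda>n. zeta2 / ln (real n) * (\<Sum>x\<in>farey n. f (real_of_rat x) / (real_of_int (den x))^2))
            \<longlonglongrightarrow> integral {0..1} f"
proof
  have "\<forall>\<^sub>F n in sequentially. (farey_transfer ^^ n) f 1 * ln n =
      ln (real n ^ 2) * (\<Sum>x\<in>SB_even n. f (real_of_rat x) / (real_of_int (den x))^2)"
    using eventually_gt_at_top[of 0] by eventually_elim (rule SB_even_sum_eq_funpow[symmetric])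
  with funpow_farey_transfer_tendsto[OF assms]
  show "(\<lambda>n. ln (real n ^ 2) * (\<Sum>x\<in>SB_even n. f (real_of_rat x) / (real_of_int (den x))^2))
      \<longlonglongrightarrow> integral {0..1} f"
    by (rule Lim_transform_eventually)
  show "(\<lambda>n. zeta2 / ln (real n) * (\<Sum>x\<in>farey n. f (real_of_rat x) / (real_of_int (den x))^2))
      \<longlonglongrightarrow> integral {0..1} f"
    unfolding sum_farey by (rule primitive_sums_tendsto[OF assms])
qed

end
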